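(* If $f\colon X\to Y$ is a map and $X$ is a locally path-connected space, then the following conditions are equivalent: (a) $f$ is a Peano covering map; (b) $f$ is a Peano fibration and has the uniqueness of path lifts property; (c) $f$ is a hedgehog fibration and has the uniqueness of path lifts property; (d) for any $x_0\in X$ and any map $g\colon (Z,z_0)\to (Y,f(x_0))$ from a simply-connected Peano space there is a lift $h\colon (Z,z_0)\to (X,x_0)$ of $g$ (i.e. $f\circ h=g$) and that lift is unique.
   Context: Maps are continuous. A Peano space is a locally path-connected and connected topological space. A hedgehog is a wedge $(Z,z_0)=\bigvee_{s\in S}(Z_s,z_s)$ indexed by a directed set $S$, where each $(Z_s,z_s)$ is homeomorphic to $(I,0)$, $I=[0,1]$, with the following topology: (1) $U\subset Z\setminus\{z_0\}$ is open iff $U\cap Z_s$ is open for each $s\in S$; (2) $U$ is an open neighborhood of $z_0$ iff there is $t\in S$ such that $Z_s\subset U$ for all $s>t$ and $U\cap Z_s$ is open (in $Z_s$) for each $s\in S$. A map $f\colon X\to Y$ has the homotopy lifting property for $K$ if for all maps $\alpha\colon K\times\{0\}\to X$ and $H\colon K\times I\to Y$ with $f\circ\alpha=H|_{K\times\{0\}}$ there is a map $G\colon K\times I\to X$ extending $\alpha$ with $f\circ G=H$. $f$ is a Serre fibration, hedgehog fibration, Peano fibration, respectively, if it has this property for $K$ being any cube $I^n$ ($n\geq 0$), any hedgehog, any Peano space. $f\colon X\to Y$ has the uniqueness of path lifts property (also called uniqueness of path lifting property) if any two paths $\alpha,\beta\colon I\to X$ with $f\circ\alpha=f\circ\beta$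 and $\alpha(0)=\beta(0)$ are equal. $f\colon X\to Y$ is a Peano map if the family of path components of $f^{-1}(U)$, $U$ open in $Y$, forms a basis of (open) neighborhoods of $X$. $f$ is a Peano covering map if it is a Peano map, it is a Serre fibration, and the fibers of $f$ have trivial (one-point) path components. *)

theory Defs
  imports "HOL-Analysis.Analysis"
begin

abbreviation unit_interval :: "real topology" where
  "unit_interval \<equiv> top_of_set {0..1}"

text \<open>Spaces are abstract topologies. A class of test spaces (all Peano spaces, all hedgehogs, ...)
  is ranged over one point type at a time, which is passed as a \<^typ>\<open>'k itself\<close> argument; all
  topologies whose underlying set is a subset of that type are considered.\<close>

definition peano_space :: "'a topology \<Rightarrow> bool" where
  "peano_space X \<longleftrightarrow> locally_path_connected_space X \<and> connected_space X"

text \<open>Every loop is homotopic to a constant loop relative to its endpoints, at every base point.\<close>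

definition simply_connected_space :: "'a topology \<Rightarrow> bool" where
  "simply_connected_space X \<longleftrightarrow> path_connected_space X \<and>
     (\<forall>z p. pathin X p \<and> p 0 = z \<and> p 1 = z \<longrightarrow>
        homotopic_with (\<lambda>q. q 0 = z \<and> q 1 = z) unit_interval X p (\<lambda>_. z))"

definition cube :: "nat \<Rightarrow> (nat \<Rightarrow> real) topology" where
  "cube n = product_topology (\<lambda>_. unit_interval) {..<n}"

definition directed_set :: "'s set \<Rightarrow> ('s \<Rightarrow> 's \<Rightarrow> bool) \<Rightarrow> bool" where
  "directed_set S le \<longleftrightarrow> S \<noteq> {} \<and> reflp_on S le \<and> transp_on S le \<and>
     (\<forall>a\<in>S. \<forall>b\<in>S. \<exists>c\<in>S. le a c \<and> le b c)"

text \<open>The space \<open>Z\<close> is the hedgehog with spines \<open>Zs s\<close>, realised as an internal wedge: the spines are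
  subsets of \<open>Z\<close> which meet pairwise exactly in the base point \<open>z0\<close>. The order is a preorder, so the
  strict relation \<open>s > t\<close> is rendered as \<open>le t s \<and> \<not> le s t\<close>.\<close>

definition hedgehog ::
  "'s set \<Rightarrow> ('s \<Rightarrow> 's \<Rightarrow> bool) \<Rightarrow> ('s \<Rightarrow> 'k topology) \<Rightarrow> 'k \<Rightarrow> 'k topology \<Rightarrow> bool" where
  "hedgehog S le Zs z0 Z \<longleftrightarrow>
     directed_set S le \<and>
     (\<forall>s\<in>S. \<exists>h. homeomorphic_map unit_interval (Zs s) h \<and> h 0 = z0) \<and>
     (\<forall>s\<in>S. \<forall>t\<in>S. s \<noteq> t \<longrightarrow> topspace (Zs s) \<inter> topspace (Zs t) = {z0}) \<and>
     topspace Z = (\<Union>s\<in>S. topspace (Zs s)) \<and>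
     (\<forall>U. U \<subseteq> topspace Z - {z0} \<longrightarrow>
        (openin Z U \<longleftrightarrow> (\<forall>s\<in>S. openin (Zs s) (U \<inter> topspace (Zs s))))) \<and>
     (\<forall>U. U \<subseteq> topspace Z \<and> z0 \<in> U \<longrightarrow>
        (openin Z U \<longleftrightarrow>
           (\<exists>t\<in>S. \<forall>s\<in>S. le t s \<and> \<not> le s t \<longrightarrow> topspace (Zs s) \<subseteq> U) \<and>
           (\<forall>s\<in>S. openin (Zs s) (U \<inter> topspace (Zs s)))))"

definition homotopy_lifting_property ::
  "'a topology \<Rightarrow> 'b topology \<Rightarrow> ('a \<Rightarrow> 'b) \<Rightarrow> 'k topology \<Rightarrow> bool" where
  "homotopy_lifting_property X Y f K \<longleftrightarrow>
     (\<forall>\<alpha> H. continuous_map (prod_topology K (top_of_set {0::real})) X \<alpha> \<and>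
        continuous_map (prod_topology K unit_interval) Y H \<and>
        (\<forall>k\<in>topspace K. f (\<alpha> (k, 0)) = H (k, 0)) \<longrightarrow>
        (\<exists>G. continuous_map (prod_topology K unit_interval) X G \<and>
           (\<forall>k\<in>topspace K. G (k, 0) = \<alpha> (k, 0)) \<and>
           (\<forall>k\<in>topspace K. \<forall>t\<in>{0..1}. f (G (k, t)) = H (k, t))))"

definition serre_fibration :: "'a topology \<Rightarrow> 'b topology \<Rightarrow> ('a \<Rightarrow> 'b) \<Rightarrow> bool" where
  "serre_fibration X Y f \<longleftrightarrow>
     continuous_map X Y f \<and> (\<forall>n. homotopy_lifting_property X Y f (cube n))"

definition peano_fibration ::
  "'k itself \<Rightarrow> 'a topology \<Rightarrow> 'b topology \<Rightarrow> ('a \<Rightarrow> 'b) \<Rightarrow> bool" where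
  "peano_fibration _ X Y f \<longleftrightarrow>
     continuous_map X Y f \<and>
     (\<forall>K::'k topology. peano_space K \<longrightarrow> homotopy_lifting_property X Y f K)"

text \<open>The type \<open>'s\<close> provides the index sets and \<open>'k\<close> the points of the hedgehogs.\<close>

definition hedgehog_fibration ::
  "'s itself \<Rightarrow> 'k itself \<Rightarrow> 'a topology \<Rightarrow> 'b topology \<Rightarrow> ('a \<Rightarrow> 'b) \<Rightarrow> bool" where
  "hedgehog_fibration _ _ X Y f \<longleftrightarrow>
     continuous_map X Y f \<and>
     (\<forall>(S::'s set) le (Zs::'s \<Rightarrow> 'k topology) z0 Z.
        hedgehog S le Zs z0 Z \<longrightarrow> homotopy_lifting_property X Y f Z)"

definition uniqueness_of_path_lifts :: "'a topology \<Rightarrow> ('a \<Rightarrow> 'b) \<Rightarrow> bool" where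
  "uniqueness_of_path_lifts X f \<longleftrightarrow>
     (\<forall>\<alpha> \<beta>. pathin X \<alpha> \<and> pathin X \<beta> \<and> (\<forall>t\<in>{0..1}. f (\<alpha> t) = f (\<beta> t)) \<and> \<alpha> 0 = \<beta> 0 \<longrightarrow>
        (\<forall>t\<in>{0..1}. \<alpha> t = \<beta> t))"

definition peano_map :: "'a topology \<Rightarrow> 'b topology \<Rightarrow> ('a \<Rightarrow> 'b) \<Rightarrow> bool" where
  "peano_map X Y f \<longleftrightarrow>
     continuous_map X Y f \<and>
     openin X = arbitrary union_of
       (\<lambda>C. \<exists>U. openin Y U \<and> C \<in> path_components_of (subtopology X {x \<in> topspace X. f x \<in> U}))"

definition peano_covering_map :: "'a topology \<Rightarrow> 'b topology \<Rightarrow> ('a \<Rightarrow> 'b) \<Rightarrow> bool" where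
  "peano_covering_map X Y f \<longleftrightarrow>
     peano_map X Y f \<and> serre_fibration X Y f \<and>
     (\<forall>y\<in>topspace Y. \<forall>C\<in>path_components_of (subtopology X {x \<in> topspace X. f x = y}).
        \<exists>x. C = {x})"

definition unique_simply_connected_lifts ::
  "'k itself \<Rightarrow> 'a topology \<Rightarrow> 'b topology \<Rightarrow> ('a \<Rightarrow> 'b) \<Rightarrow> bool" where
  "unique_simply_connected_lifts _ X Y f \<longleftrightarrow>
     (\<forall>x0\<in>topspace X. \<forall>(Z::'k topology) z0 g.
        peano_space Z \<and> simply_connected_space Z \<and> z0 \<in> topspace Z \<and>
        continuous_map Z Y g \<and> g z0 = f x0 \<longrightarrow>
        (\<exists>h. (continuous_map Z X h \<and> h z0 = x0 \<and> (\<forall>z\<in>topspace Z. f (h z) = g z)) \<and>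
           (\<forall>h'. continuous_map Z X h' \<and> h' z0 = x0 \<and> (\<forall>z\<in>topspace Z. f (h' z) = g z) \<longrightarrow>
              (\<forall>z\<in>topspace Z. h' z = h z))))"

text \<open>HOL cannot quantify over types inside a formula, so ``for all Peano spaces'' is expressed in
  two halves. Necessity is stated for test spaces over arbitrary types (free type variables).
  Sufficiency is stated for test spaces over the following single type, which depends only on the
  point type of the base: it has room for all cubes and for the hedgehogs indexed by pairs of
  a neighbourhood in the base and a natural number (the latter so that the index set has no maximal
  element). Together the two halves say that the equivalence holds with quantification over all types.\<close>

type_synonym 'b test_point = "('b set \<times> nat) \<times> (nat \<Rightarrow> real)"

end

theory Submission
  imports Defs
begin

text \<open>All conditions are equivalent to the following three together: \<open>f\<close> is a Peano map, paths have at
  most one lift from a given point, and homotopies over the interval can be lifted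
  (\<open>peano_covering_map_iff\<close>).

  These three properties give all lifts. A lift is first built pointwise from lifts of paths, and the
  only question is its continuity. For a Peano map, points that are joined by a path over a small open
  set are close, so over a locally path-connected space it is enough that the lift is continuous along
  paths (\<open>continuous_lift_if_continuous_on_paths\<close>). Along a path, lifting over the interval applies. This yields
  homotopy lifting for all locally path-connected spaces and, with the usual monodromy argument, lifts
  from simply connected Peano spaces (\<open>homotopy_lifting_property_locally_path_connected\<close>,
  \<open>lift_from_simply_connected\<close>).

  For the converse, the interval and the square are among the test spaces, which settles lifting over
  the interval and uniqueness. That \<open>f\<close> is a Peano map is tested by hedgehogs: if it fails at \<open>x0\<close>, then
  there are paths from \<open>x0\<close> with arbitrarily small image that all leave a fixed neighbourhood of \<open>x0\<close>,
  and their images assemble to a map from a hedgehog that has no continuous lift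
  (\<open>peano_map_if_lifts_from_hedgehogs\<close>). Hedgehogs are Peano spaces and contract to their base points.
  Therefore each of the lifting conditions provides such lifts.\<close>

section \<open>Homotopy lifting\<close>

text \<open>A map on the one-point cylinder over \<open>K\<close> is the same as a map on \<open>K\<close>; in this form the initial lift
  composes directly with other maps.\<close>

lemma homotopy_lifting_property_iff:
  "homotopy_lifting_property X Y f K \<longleftrightarrow>
     (\<forall>a H. continuous_map K X a \<and> continuous_map (prod_topology K unit_interval) Y H \<and>
        (\<forall>k\<in>topspace K. f (a k) = H (k, 0)) \<longrightarrow>
        (\<exists>G. continuous_map (prod_topology K unit_interval) X G \<and>
           (\<forall>k\<in>topspace K. G (k, 0) = a k) \<and>
           (\<forall>k\<in>topspace K. \<forall>t\<in>{0..1}. f (G (k, t)) = H (k, t))))"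
  (is "?L \<longleftrightarrow> ?R")
proof
  assume L: ?L
  show ?R
  proof (intro allI impI, elim conjE)
    fix a H
    assume a: "continuous_map K X a" and H: "continuous_map (prod_topology K unit_interval) Y H"
      and eq: "\<forall>k\<in>topspace K. f (a k) = H (k, 0)"
    have "continuous_map (prod_topology K (top_of_set {0::real})) X (a \<circ> fst)"
      by (rule continuous_map_compose[OF continuous_map_fst a])
    then show "\<exists>G. continuous_map (prod_topology K unit_interval) X G \<and>
           (\<forall>k\<in>topspace K. G (k, 0) = a k) \<and>
           (\<forall>k\<in>topspace K. \<forall>t\<in>{0..1}. f (G (k, t)) = H (k, t))"
      using L[unfolded homotopy_lifting_property_def, rule_format, of "a \<circ> fst" H] H eq by auto
  qed
next
  assume R: ?R
  show ?L
    unfolding homotopy_lifting_property_def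
  proof (intro allI impI, elim conjE)
    fix \<alpha> H
    assume a: "continuous_map (prod_topology K (top_of_set {0::real})) X \<alpha>"
      and H: "continuous_map (prod_topology K unit_interval) Y H"
      and eq: "\<forall>k\<in>topspace K. f (\<alpha> (k, 0)) = H (k, 0)"
    have "continuous_map K (prod_topology K (top_of_set {0::real})) (\<lambda>k. (k, 0))"
      by (simp add: continuous_map_pairedI)
    from continuous_map_compose[OF this a]
    have "continuous_map K X (\<lambda>k. \<alpha> (k, 0))" by (simp add: o_def)
    with R H eq show "\<exists>G. continuous_map (prod_topology K unit_interval) X G \<and>
           (\<forall>k\<in>topspace K. G (k, 0) = \<alpha> (k, 0)) \<and>
           (\<forall>k\<in>topspace K. \<forall>t\<in>{0..1}. f (G (k, t)) = H (k, t))"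
      by blast
  qed
qed

lemma homotopy_lift:
  assumes "homotopy_lifting_property X Y f K" and "continuous_map K X a"
    and "continuous_map (prod_topology K unit_interval) Y H"
    and "\<And>k. k \<in> topspace K \<Longrightarrow> f (a k) = H (k, 0)"
  obtains G where "continuous_map (prod_topology K unit_interval) X G"
    "\<And>k. k \<in> topspace K \<Longrightarrow> G (k, 0) = a k"
    "\<And>k t. k \<in> topspace K \<Longrightarrow> t \<in> {0..1} \<Longrightarrow> f (G (k, t)) = H (k, t)"
proof -
  have "\<exists>G. continuous_map (prod_topology K unit_interval) X G \<and>
      (\<forall>k\<in>topspace K. G (k, 0) = a k) \<and>
      (\<forall>k\<in>topspace K. \<forall>t\<in>{0..1}. f (G (k, t)) = H (k, t))"
    by (rule assms(1)[unfolded homotopy_lifting_property_iff, rule_format]) (use assms(2-) in simp)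
  then show thesis
    using that by blast
qed

text \<open>A lifting problem on the retract is pulled back along the retraction, solved, and the solution is
  restricted along the section. It serves to pass to the interval from one of its copies
  or from the cube of dimension one.\<close>

lemma homotopy_lifting_property_retract:
  assumes "retraction_maps K L r s" and "homotopy_lifting_property X Y f K"
  shows "homotopy_lifting_property X Y f L"
  unfolding homotopy_lifting_property_iff
proof (intro allI impI, elim conjE)
  fix a H
  assume a: "continuous_map L X a" and H: "continuous_map (prod_topology L unit_interval) Y H"
    and eq: "\<forall>l\<in>topspace L. f (a l) = H (l, 0)"
  have r: "continuous_map K L r" and s: "continuous_map L K s"
    and rs: "\<And>l. l \<in> topspace L \<Longrightarrow> r (s l) = l"
    using assms(1) by (auto simp: retraction_maps_def)
  have rI: "continuous_map (prod_topology K unit_interval) (prod_topology L unit_interval)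
      (\<lambda>(k, t). (r k, t))"
    and sI: "continuous_map (prod_topology L unit_interval) (prod_topology K unit_interval)
      (\<lambda>(l, t). (s l, t))"
    using r s by (auto simp: continuous_map_prod_top)
  have "continuous_map K X (a \<circ> r)"
    by (rule continuous_map_compose[OF r a])
  moreover have "continuous_map (prod_topology K unit_interval) Y (H \<circ> (\<lambda>(k, t). (r k, t)))"
    by (rule continuous_map_compose[OF rI H])
  moreover have "\<forall>k\<in>topspace K. f ((a \<circ> r) k) = (H \<circ> (\<lambda>(k, t). (r k, t))) (k, 0)"
    using eq r by (auto simp: continuous_map_def)
  ultimately obtain G where G: "continuous_map (prod_topology K unit_interval) X G"
    "\<And>k. k \<in> topspace K \<Longrightarrow> G (k, 0) = (a \<circ> r) k"
    "\<And>k t. k \<in> topspace K \<Longrightarrow> t \<in> {0..1} \<Longrightarrow> f (G (k, t)) = (H \<circ> (\<lambda>(k, t). (r k, t))) (k, t)"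
    using homotopy_lift[OF assms(2), of "a \<circ> r" "H \<circ> (\<lambda>(k, t). (r k, t))"] by blast
  have sK: "s l \<in> topspace K" if "l \<in> topspace L" for l
    using s that by (auto simp: continuous_map_def)
  show "\<exists>G. continuous_map (prod_topology L unit_interval) X G \<and>
           (\<forall>l\<in>topspace L. G (l, 0) = a l) \<and>
           (\<forall>l\<in>topspace L. \<forall>t\<in>{0..1}. f (G (l, t)) = H (l, t))"
  proof (intro exI conjI)
    show "continuous_map (prod_topology L unit_interval) X (G \<circ> (\<lambda>(l, t). (s l, t)))"
      by (rule continuous_map_compose[OF sI G(1)])
  qed (use G(2,3) sK rs in auto)
qed

lemma continuous_map_into_unit_interval:
  assumes "continuous_map T euclideanreal p" and "\<And>x. x \<in> topspace T \<Longrightarrow> 0 \<le> p x \<and> p x \<le> 1"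
  shows "continuous_map T unit_interval p"
  using assms by (auto simp: continuous_map_in_subtopology)

lemma continuous_map_real_of_unit_interval:
  "continuous_map T unit_interval p \<Longrightarrow> continuous_map T euclideanreal p"
  by (simp add: continuous_map_in_subtopology)

lemma pathin_reparam:
  assumes "pathin X p" and "continuous_on {0..1} \<phi>" and "\<phi> \<in> {0..1} \<rightarrow> {0..1::real}"
  shows "pathin X (\<lambda>t. p (\<phi> t))"
proof -
  have "continuous_map unit_interval unit_interval \<phi>"
    using assms by (auto simp: continuous_map_in_subtopology)
  then show ?thesis
    using continuous_map_compose[OF _ assms(1)[unfolded pathin_def], of unit_interval \<phi>]
    unfolding pathin_def by (simp add: o_def)
qed

lemma path_component_of_segment:
  assumes "pathin X p" and "s \<in> {0..1}" and "t \<in> {0..1}"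
  shows "path_component_of X (p s) (p t)"
proof -
  have "pathin X (\<lambda>u. p ((1 - u) * s + u * t))"
  proof (rule pathin_reparam[OF assms(1)])
    show "(\<lambda>u. (1 - u) * s + u * t) \<in> {0..1} \<rightarrow> {0..1}"
      using assms(2,3) convex_bound_le[of s 1 t] by (auto simp: )
  qed (intro continuous_intros)
  then show ?thesis
    unfolding path_component_of_def
    by (intro exI[of _ "\<lambda>u. p ((1 - u) * s + u * t)"]) auto
qed

lemma pathin_join:
  assumes "pathin X g" "pathin X h" "g 1 = h 0"
  shows "pathin X (\<lambda>t. if t \<le> 1/2 then g (2 * t) else h (2 * t - 1))"
proof -
  have g: "pathin X (\<lambda>t. g (min 1 (2 * t)))"
    by (rule pathin_reparam[OF assms(1)]) (auto intro!: continuous_intros)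
  have h: "pathin X (\<lambda>t. h (max 0 (2 * t - 1)))"
    by (rule pathin_reparam[OF assms(2)]) (auto intro!: continuous_intros)
  have "continuous_map unit_interval X
      (\<lambda>t. if t \<le> 1/2 then g (min 1 (2 * t)) else h (max 0 (2 * t - 1)))"
    by (rule continuous_map_cases_le)
       (use g h assms(3) in \<open>auto simp: pathin_def continuous_map_from_subtopology\<close>)
  then show ?thesis
    unfolding pathin_def by (rule continuous_map_eq) auto
qed

text \<open>A point together with a path is a homotopy on the interval that ignores the space parameter.\<close>

lemma path_lift:
  assumes "homotopy_lifting_property X Y f unit_interval"
    and "pathin Y \<gamma>" and "x \<in> topspace X" and "f x = \<gamma> 0"
  obtains p where "pathin X p" "p 0 = x" "\<And>t. t \<in> {0..1} \<Longrightarrow> f (p t) = \<gamma> t"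
proof -
  have H: "continuous_map (prod_topology unit_interval unit_interval) Y (\<gamma> \<circ> snd)"
    by (rule continuous_map_compose[OF continuous_map_snd assms(2)[unfolded pathin_def]])
  have a: "continuous_map unit_interval X (\<lambda>_. x)"
    using assms(3) by simp
  obtain G where G: "continuous_map (prod_topology unit_interval unit_interval) X G"
    "\<And>k. k \<in> topspace unit_interval \<Longrightarrow> G (k, 0) = x"
    "\<And>k t. k \<in> topspace unit_interval \<Longrightarrow> t \<in> {0..1} \<Longrightarrow> f (G (k, t)) = (\<gamma> \<circ> snd) (k, t)"
    using homotopy_lift[OF assms(1) a H] assms(4) by (metis comp_apply snd_conv)
  have "pathin X (\<lambda>t. G (0, t))"
    using continuous_map_o_Pair[OF G(1), of 0] by (simp add: pathin_def o_def)
  then show thesis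
    by (rule that) (use G in auto)
qed

lemma path_with_constant_image:
  assumes "uniqueness_of_path_lifts X f" and "pathin X p"
    and "\<And>t. t \<in> {0..1} \<Longrightarrow> f (p t) = y" and "t \<in> {0..1}"
  shows "p t = p 0"
proof -
  have "p 0 \<in> topspace X"
    using assms(2) path_start_in_topspace by blast
  then show ?thesis
    using assms(1)[unfolded uniqueness_of_path_lifts_def, rule_format, of p "\<lambda>_. p 0" t] assms
    by auto
qed

lemma path_components_of_fibre_trivial:
  assumes "uniqueness_of_path_lifts X f"
    and "C \<in> path_components_of (subtopology X {x \<in> topspace X. f x = y})"
  shows "\<exists>x. C = {x}"
proof -
  let ?F = "subtopology X {x \<in> topspace X. f x = y}"
  obtain x where x: "x \<in> topspace ?F" "C = Collect (path_component_of ?F x)"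
    using assms(2) by (auto simp: path_components_of_def)
  have "x' = x" if x': "path_component_of ?F x x'" for x'
  proof -
    obtain p where p: "pathin ?F p" "p 0 = x" "p 1 = x'"
      using x' by (auto simp: path_component_of_def)
    then show ?thesis
      using path_with_constant_image[OF assms(1), of p y 1] by (auto simp: pathin_subtopology)
  qed
  then show ?thesis
    using x path_component_of_refl[of ?F x] by blast
qed

section \<open>Unique path lifting and fibres\<close>

text \<open>If \<open>\<alpha>\<close> and \<open>\<beta>\<close> lift the same path \<open>\<gamma>\<close> from the same point, then \<open>\<alpha>\<close> run backwards followed by
  \<open>\<beta>\<close> is a lift of the path that runs along \<open>\<gamma>\<close> from its end to its start and back. That path can be
  pulled back to the constant path at the end of \<open>\<gamma>\<close>, with both ends at rest. The lifted homotopy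
  traces, along the three free sides of the square, a path in one fibre from \<open>\<alpha> 1\<close> to \<open>\<beta> 1\<close>; as path
  components of fibres are points, these ends agree.\<close>

lemma uniqueness_of_path_lifts_if_fibres_trivial:
  assumes hlp: "homotopy_lifting_property X Y f unit_interval" and f: "continuous_map X Y f"
    and triv: "\<forall>y\<in>topspace Y. \<forall>C\<in>path_components_of (subtopology X {x \<in> topspace X. f x = y}). \<exists>x. C = {x}"
  shows "uniqueness_of_path_lifts X f"
proof -
  have fibre: "x = x'" if "pathin X p" "\<And>t. t \<in> {0..1} \<Longrightarrow> f (p t) = y" "s \<in> {0..1}" "s' \<in> {0..1}"
    "p s = x" "p s' = x'" for x x' p y s s'
  proof -
    let ?F = "subtopology X {x \<in> topspace X. f x = y}"
    have "p t \<in> topspace X" if "t \<in> {0..1}" for t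
      using path_image_subset_topspace[OF \<open>pathin X p\<close>] that by auto
    then have "pathin ?F p"
      using that by (auto simp: pathin_subtopology)
    then have pc: "path_component_of ?F x x'"
      using path_component_of_segment[of ?F p s s'] that by auto
    then have "x \<in> topspace ?F"
      using path_component_in_topspace by fast
    moreover have "Collect (path_component_of ?F x) \<in> path_components_of ?F"
      using \<open>x \<in> topspace ?F\<close> by (simp add: path_components_of_def)
    moreover have "y \<in> topspace Y"
      using \<open>x \<in> topspace ?F\<close> f by (auto simp: continuous_map_def)
    ultimately obtain c where "Collect (path_component_of ?F x) = {c}"
      using triv by blast
    then show ?thesis
      using pc path_component_of_refl[of ?F x] \<open>x \<in> topspace ?F\<close> by (metis mem_Collect_eq singletonD)
  qed
  have endpoints: "\<alpha> 1 = \<beta> 1" if ab: "pathin X \<alpha>" "pathin X \<beta>" "\<alpha> 0 = \<beta> 0"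
    and eq: "\<And>t. t \<in> {0..1} \<Longrightarrow> f (\<alpha> t) = f (\<beta> t)" for \<alpha> \<beta>
  proof -
    define \<sigma> where "\<sigma> t = (if t \<le> 1/2 then \<alpha> (1 - 2 * t) else \<beta> (2 * t - 1))" for t
    have "pathin X (\<lambda>t. \<alpha> (1 - t))"
      by (rule pathin_reparam[OF ab(1)]) (auto intro!: continuous_intros)
    from pathin_join[OF this ab(2)] have \<sigma>: "pathin X \<sigma>"
      using ab(3) by (simp add: \<sigma>_def[abs_def])
    \<comment> \<open>At time \<open>0\<close> this is \<open>f \<circ> \<sigma>\<close>; it is constant on the sides \<open>fst z = 0\<close>, \<open>fst z = 1\<close> and \<open>snd z = 1\<close>.\<close>
    define H where "H = (\<lambda>z. f (\<alpha> (max \<bar>2 * fst z - 1\<bar> (snd z))))"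
    have "continuous_map (prod_topology unit_interval unit_interval) unit_interval
        (\<lambda>z. max \<bar>2 * fst z - 1\<bar> (snd z))"
      by (auto simp: continuous_map_in_subtopology prod_topology_subtopology_eu intro!: continuous_intros)
    then have "continuous_map (prod_topology unit_interval unit_interval) Y H"
      using continuous_map_compose[OF continuous_map_compose[OF _ ab(1)[unfolded pathin_def]] f]
      unfolding H_def o_def by blast
    moreover have "\<forall>k\<in>topspace unit_interval. f (\<sigma> k) = H (k, 0)"
      using eq by (auto simp: H_def \<sigma>_def max_def abs_if)
    ultimately obtain G where G: "continuous_map (prod_topology unit_interval unit_interval) X G"
      "\<And>k. k \<in> {0..1} \<Longrightarrow> G (k, 0) = \<sigma> k"
      "\<And>k t. k \<in> {0..1} \<Longrightarrow> t \<in> {0..1} \<Longrightarrow> f (G (k, t)) = H (k, t)"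
      using homotopy_lift[OF hlp, of \<sigma> H] \<sigma> unfolding pathin_def topspace_euclidean_subtopology by blast
    have Gv: "pathin X (\<lambda>t. G (k, t))" if "k \<in> {0..1}" for k
      using continuous_map_o_Pair[OF G(1), of k] that by (simp add: pathin_def o_def)
    have Gh: "pathin X (\<lambda>k. G (k, 1))"
    proof -
      have "continuous_map unit_interval (prod_topology unit_interval unit_interval) (\<lambda>k. (k, 1))"
        by (auto intro!: continuous_intros)
      from continuous_map_compose[OF this G(1)] show ?thesis
        by (simp add: pathin_def o_def)
    qed
    have "\<alpha> 1 = G (0, 1)"
      by (rule fibre[OF Gv[of 0], of "f (\<alpha> 1)" 0 1]) (use G in \<open>auto simp: H_def \<sigma>_def max_def\<close>)
    also have "\<dots> = G (1, 1)"
      by (rule fibre[OF Gh, of "f (\<alpha> 1)" 0 1]) (use G in \<open>auto simp: H_def max_def\<close>)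
    also have "\<dots> = \<beta> 1"
      by (rule fibre[OF Gv[of 1], of "f (\<alpha> 1)" 1 0]) (use G in \<open>auto simp: H_def \<sigma>_def max_def\<close>)
    finally show ?thesis .
  qed
  show ?thesis
    unfolding uniqueness_of_path_lifts_def
  proof (intro allI impI ballI, elim conjE)
    fix \<alpha> \<beta> and t :: real
    assume *: "pathin X \<alpha>" "pathin X \<beta>" "\<forall>t\<in>{0..1}. f (\<alpha> t) = f (\<beta> t)" "\<alpha> 0 = \<beta> 0" "t \<in> {0..1}"
    have st: "(\<lambda>s. s * t) \<in> {0..1} \<rightarrow> {0..1}"
      using *(5) by (auto simp: mult_le_one)
    have "continuous_on {0..1} (\<lambda>s. s * t)"
      by (intro continuous_intros)
    from endpoints[OF pathin_reparam[OF *(1) this st] pathin_reparam[OF *(2) this st]]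
    show "\<alpha> t = \<beta> t"
      using *(3,4) st by (auto simp: Pi_iff)
  qed
qed

section \<open>Lifting along Peano maps\<close>

text \<open>The path components in question are open already because the domain is locally path-connected, so
  all that a Peano map adds is that they are small.\<close>

lemma peano_map_iff:
  assumes "continuous_map X Y f" and "locally_path_connected_space X"
  shows "peano_map X Y f \<longleftrightarrow> (\<forall>V x. openin X V \<and> x \<in> V \<longrightarrow> (\<exists>U. openin Y U \<and> f x \<in> U \<and>
    Collect (path_component_of (subtopology X {x \<in> topspace X. f x \<in> U}) x) \<subseteq> V))" (is "_ \<longleftrightarrow> ?R")
proof -
  let ?P = "\<lambda>U. subtopology X {x \<in> topspace X. f x \<in> U}"
  let ?B = "\<lambda>C. \<exists>U. openin Y U \<and> C \<in> path_components_of (?P U)"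
  have component: "C = Collect (path_component_of (?P U) x)" "f x \<in> U"
    if C: "C \<in> path_components_of (?P U)" "x \<in> C" for C U x
  proof -
    obtain x1 where "C = Collect (path_component_of (?P U) x1)"
      using C by (auto simp: path_components_of_def)
    with C(2) have "path_component_of (?P U) x1 x" by simp
    then show "C = Collect (path_component_of (?P U) x)" "f x \<in> U"
      using \<open>C = _\<close> path_component_of_equiv[of "?P U" x1 x] by auto
  qed
  have base: "openin X C" if C: "?B C" for C
  proof -
    obtain U where "openin Y U" "C \<in> path_components_of (?P U)"
      using C by blast
    then show ?thesis
      using assms openin_continuous_map_preimage[OF assms(1), of U]
      unfolding locally_path_connected_space_open_path_components by blast
  qed
  show ?thesis
  proof
    assume "peano_map X Y f"
    then have open_eq: "openin X = arbitrary union_of ?B"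
      unfolding peano_map_def by (rule conjunct2)
    have pm: "openin X V \<longleftrightarrow> (\<forall>x\<in>V. \<exists>C. ?B C \<and> x \<in> C \<and> C \<subseteq> V)" for V
      using fun_cong[OF open_eq, of V] by (simp only: arbitrary_union_of_alt)
    show ?R
    proof (intro allI impI, elim conjE)
      fix V x
      assume "openin X V" "x \<in> V"
      with pm[of V] obtain C where "?B C" "x \<in> C" "C \<subseteq> V"
        by blast
      then obtain U where U: "openin Y U" "C \<in> path_components_of (?P U)"
        by blast
      show "\<exists>U. openin Y U \<and> f x \<in> U \<and> Collect (path_component_of (?P U) x) \<subseteq> V"
        using U(1) component[OF U(2) \<open>x \<in> C\<close>] \<open>C \<subseteq> V\<close> by (intro exI[of _ U]) simp
    qed
  next
    assume R: ?R
    have "openin X V \<longleftrightarrow> (arbitrary union_of ?B) V" for V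
    proof
      assume V: "openin X V"
      show "(arbitrary union_of ?B) V"
        unfolding arbitrary_union_of_alt
      proof
        fix x assume "x \<in> V"
        then obtain U where U: "openin Y U" "f x \<in> U" "Collect (path_component_of (?P U) x) \<subseteq> V"
          using R V by blast
        moreover have "x \<in> topspace (?P U)"
          using U(2) \<open>x \<in> V\<close> V openin_subset by fastforce
        ultimately show "\<exists>C. ?B C \<and> x \<in> C \<and> C \<subseteq> V"
          using path_component_of_refl[of "?P U" x]
          by (intro exI[of _ "Collect (path_component_of (?P U) x)"]) (auto simp: path_components_of_def)
      qed
    next
      assume "(arbitrary union_of ?B) V"
      then show "openin X V"
        unfolding arbitrary_union_of_alt using base openin_subopen[of X V] by metis
    qed
    then show "peano_map X Y f"
      using assms(1) unfolding peano_map_def by auto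
  qed
qed

text \<open>Near a point \<open>k\<close>, a path-connected neighbourhood that \<open>H\<close> sends into a small open set \<open>U\<close> is carried
  by \<open>G\<close>, path by path, into a single path component of the preimage of \<open>U\<close>. For a Peano map that
  component is as small as desired. Hence a set-theoretic lift needs to be continuous on paths only.\<close>

lemma continuous_lift_if_continuous_on_paths:
  assumes lpcX: "locally_path_connected_space X" and f: "continuous_map X Y f" and "peano_map X Y f"
    and "locally_path_connected_space K" and H: "continuous_map K Y H"
    and fG: "\<And>k. k \<in> topspace K \<Longrightarrow> f (G k) = H k"
    and path: "\<And>p. pathin K p \<Longrightarrow> pathin X (\<lambda>t. G (p t))"
  shows "continuous_map K X G"
proof -
  have GX: "G k \<in> topspace X" if "k \<in> topspace K" for k
    using path[of "\<lambda>_. k"] that by simp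
  have "openin K {k \<in> topspace K. G k \<in> V}" if V: "openin X V" for V
  proof (subst openin_subopen, intro ballI)
    fix k assume k: "k \<in> {k \<in> topspace K. G k \<in> V}"
    then obtain U where U: "openin Y U" "f (G k) \<in> U"
      "Collect (path_component_of (subtopology X {x \<in> topspace X. f x \<in> U}) (G k)) \<subseteq> V"
      using V assms(3) unfolding peano_map_iff[OF f lpcX] by blast
    let ?N = "{k \<in> topspace K. H k \<in> U}"
    let ?W = "Collect (path_component_of (subtopology K ?N) k)"
    have N: "openin K ?N"
      using openin_continuous_map_preimage[OF H U(1)] .
    have kN: "k \<in> ?N"
      using k U(2) fG by auto
    have "openin K ?W"
      using assms(4) N kN unfolding locally_path_connected_space_eq_open_path_component_of by blast
    moreover have "k \<in> ?W"
      using kN by (simp add: path_component_of_refl)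
    moreover have "?W \<subseteq> {k \<in> topspace K. G k \<in> V}"
    proof
      fix k' assume "k' \<in> ?W"
      then obtain p where p: "pathin (subtopology K ?N) p" "p 0 = k" "p 1 = k'"
        by (auto simp: path_component_of_def)
      then have pN: "pathin K p" "\<And>t. t \<in> {0..1} \<Longrightarrow> p t \<in> ?N"
        by (auto simp: pathin_subtopology)
      then have "pathin (subtopology X {x \<in> topspace X. f x \<in> U}) (\<lambda>t. G (p t))"
        using path[OF pN(1)] fG GX by (auto simp: pathin_subtopology)
      then have "path_component_of (subtopology X {x \<in> topspace X. f x \<in> U}) (G k) (G k')"
        unfolding path_component_of_def using p by (intro exI[of _ "\<lambda>t. G (p t)"]) auto
      moreover have "k' \<in> topspace K"
        using pN(2)[of 1] p by auto
      ultimately show "k' \<in> {k \<in> topspace K. G k \<in> V}"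
        using U(3) by auto
    qed
    ultimately show "\<exists>T. openin K T \<and> k \<in> T \<and> T \<subseteq> {k \<in> topspace K. G k \<in> V}"
      by blast
  qed
  then show ?thesis
    using GX by (auto simp: continuous_map_def)
qed

text \<open>Lifting each track \<open>t \<mapsto> H (k, t)\<close> separately gives a unique candidate \<open>G\<close>. Along a path in \<open>K\<close> the
  homotopy becomes one over the interval, which has a continuous lift; by uniqueness that lift consists
  of the chosen tracks, so \<open>G\<close> is continuous on paths.\<close>

lemma homotopy_lifting_property_locally_path_connected:
  assumes lpcX: "locally_path_connected_space X" and f: "continuous_map X Y f" and pm: "peano_map X Y f"
    and hlp: "homotopy_lifting_property X Y f unit_interval"
    and uniq: "uniqueness_of_path_lifts X f" and K: "locally_path_connected_space K"
  shows "homotopy_lifting_property X Y f K"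
  unfolding homotopy_lifting_property_iff
proof (intro allI impI, elim conjE)
  fix a H
  assume a: "continuous_map K X a" and H: "continuous_map (prod_topology K unit_interval) Y H"
    and eq: "\<forall>k\<in>topspace K. f (a k) = H (k, 0)"
  have "\<exists>p. pathin X p \<and> p 0 = a k \<and> (\<forall>t\<in>{0..1}. f (p t) = H (k, t))" if k: "k \<in> topspace K" for k
  proof -
    have "pathin Y (\<lambda>t. H (k, t))"
      using continuous_map_o_Pair[OF H k] by (simp add: pathin_def o_def)
    moreover have "a k \<in> topspace X"
      using a k by (auto simp: continuous_map_def)
    ultimately obtain p where "pathin X p" "p 0 = a k" "\<And>t. t \<in> {0..1} \<Longrightarrow> f (p t) = H (k, t)"
      using path_lift[OF hlp, of "\<lambda>t. H (k, t)" "a k"] eq k by blast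
    then show ?thesis
      by blast
  qed
  then have "\<forall>k\<in>topspace K. \<exists>p. pathin X p \<and> p 0 = a k \<and> (\<forall>t\<in>{0..1}. f (p t) = H (k, t))"
    by blast
  from bchoice[OF this] obtain g where g: "\<And>k. k \<in> topspace K \<Longrightarrow> pathin X (g k)"
    "\<And>k. k \<in> topspace K \<Longrightarrow> g k 0 = a k"
    "\<And>k t. k \<in> topspace K \<Longrightarrow> t \<in> {0..1} \<Longrightarrow> f (g k t) = H (k, t)"
    by blast
  let ?G = "\<lambda>(k, t). g k t"
  have "continuous_map (prod_topology K unit_interval) X ?G"
  proof (rule continuous_lift_if_continuous_on_paths[OF lpcX f pm _ H])
    show "locally_path_connected_space (prod_topology K unit_interval)"
      using K locally_path_connected_real_interval(1)[of 0 1]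
      by (simp add: locally_path_connected_space_prod_topology)
    show "f (?G k) = H k" if "k \<in> topspace (prod_topology K unit_interval)" for k
      using g(3) that by (cases k) auto
  next
    fix q assume q: "pathin (prod_topology K unit_interval) q"
    define k where "k = (\<lambda>s. fst (q s))"
    define u where "u = (\<lambda>s. snd (q s))"
    have k: "continuous_map unit_interval K k" and u: "continuous_map unit_interval unit_interval u"
      using q unfolding pathin_def k_def u_def by (auto simp: continuous_map_pairwise o_def)
    have kK: "k s \<in> topspace K" and u01: "u s \<in> {0..1}" if "s \<in> {0..1}" for s
      using k u that by (auto simp: continuous_map_def)
    have "continuous_map (prod_topology unit_interval unit_interval) (prod_topology K unit_interval)
        (\<lambda>(s, t). (k s, t))"
      by (auto simp: case_prod_unfold intro!: continuous_map_pairedI continuous_map_snd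
          continuous_map_compose[OF continuous_map_fst k, unfolded o_def]
          simp del: prod_topology_subtopology_eu)
    from continuous_map_compose[OF this H]
    have "continuous_map (prod_topology unit_interval unit_interval) Y (\<lambda>(s, t). H (k s, t))"
      by (simp add: o_def case_prod_unfold)
    moreover have "continuous_map unit_interval X (\<lambda>s. a (k s))"
      using continuous_map_compose[OF k a] by (simp add: o_def)
    moreover have "\<forall>s\<in>topspace unit_interval. f (a (k s)) = (\<lambda>(s, t). H (k s, t)) (s, 0)"
      using eq kK by auto
    ultimately obtain G where G: "continuous_map (prod_topology unit_interval unit_interval) X G"
      "\<And>s. s \<in> topspace unit_interval \<Longrightarrow> G (s, 0) = a (k s)"
      "\<And>s t. s \<in> topspace unit_interval \<Longrightarrow> t \<in> {0..1} \<Longrightarrow> f (G (s, t)) = (\<lambda>(s, t). H (k s, t)) (s, t)"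
      using homotopy_lift[OF hlp, of "\<lambda>s. a (k s)" "\<lambda>(s, t). H (k s, t)"] by blast
    have Gg: "G (s, t) = g (k s) t" if st: "s \<in> {0..1}" "t \<in> {0..1}" for s t
    proof -
      have "pathin X (\<lambda>t. G (s, t))"
        using continuous_map_o_Pair[OF G(1), of s] st by (simp add: pathin_def o_def)
      then show ?thesis
        using uniq[unfolded uniqueness_of_path_lifts_def, rule_format, of "\<lambda>t. G (s, t)" "g (k s)" t]
          g G kK st by auto
    qed
    have "continuous_map unit_interval (prod_topology unit_interval unit_interval) (\<lambda>s. (s, u s))"
      by (rule continuous_map_pairedI[OF _ u]) simp
    from continuous_map_compose[OF this G(1)]
    have "continuous_map unit_interval X (\<lambda>s. ?G (q s))"
      by (rule continuous_map_eq) (use Gg u01 in \<open>auto simp: k_def u_def case_prod_unfold\<close>)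
    then show "pathin X (\<lambda>s. ?G (q s))"
      by (simp add: pathin_def)
  qed
  then show "\<exists>G. continuous_map (prod_topology K unit_interval) X G \<and>
           (\<forall>k\<in>topspace K. G (k, 0) = a k) \<and>
           (\<forall>k\<in>topspace K. \<forall>t\<in>{0..1}. f (G (k, t)) = H (k, t))"
    using g by (intro exI[of _ ?G]) auto
qed

text \<open>Lift the null homotopy of the projected loop. Three sides of the square are mapped to the base point,
  so the lift is constant on each of them, and they connect the two ends of the fourth side.\<close>

lemma loop_lift_closed:
  assumes hlp: "homotopy_lifting_property X Y f unit_interval"
    and uniq: "uniqueness_of_path_lifts X f"
    and Z: "simply_connected_space Z" and g: "continuous_map Z Y g"
    and p: "pathin Z p" "p 0 = p 1" and q: "pathin X q" "\<And>t. t \<in> {0..1} \<Longrightarrow> f (q t) = g (p t)"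
  shows "q 1 = q 0"
proof -
  have "homotopic_with (\<lambda>q. q 0 = p 0 \<and> q 1 = p 0) unit_interval Z p (\<lambda>_. p 0)"
    using Z[unfolded simply_connected_space_def, THEN conjunct2, rule_format, of p "p 0"] p by simp
  then obtain L where L: "continuous_map (prod_topology unit_interval unit_interval) Z L"
    "\<And>t. L (0, t) = p t" "\<And>t. L (1, t) = p 0"
    "\<And>u. u \<in> {0..1} \<Longrightarrow> L (u, 0) = p 0 \<and> L (u, 1) = p 0"
    unfolding homotopic_with_def by blast
  have "continuous_map (prod_topology unit_interval unit_interval)
      (prod_topology unit_interval unit_interval) (\<lambda>(t, u). (u, t))"
    by (auto simp: case_prod_unfold intro!: continuous_intros)
  from continuous_map_compose[OF continuous_map_compose[OF this L(1)] g]
  have H: "continuous_map (prod_topology unit_interval unit_interval) Y (\<lambda>(t, u). g (L (u, t)))"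
    by (simp add: o_def case_prod_unfold)
  then obtain G where G: "continuous_map (prod_topology unit_interval unit_interval) X G"
    "\<And>t. t \<in> {0..1} \<Longrightarrow> G (t, 0) = q t"
    "\<And>t u. t \<in> {0..1} \<Longrightarrow> u \<in> {0..1} \<Longrightarrow> f (G (t, u)) = g (L (u, t))"
    using homotopy_lift[OF hlp _ H, of q] q L(2) by (auto simp: pathin_def)
  have Gv: "pathin X (\<lambda>u. G (t, u))" if "t \<in> {0..1}" for t
    using continuous_map_o_Pair[OF G(1), of t] that by (simp add: pathin_def o_def)
  have Gh: "pathin X (\<lambda>t. G (t, 1))"
  proof -
    have "continuous_map unit_interval (prod_topology unit_interval unit_interval) (\<lambda>k. (k, 1))"
      by (auto intro!: continuous_intros)
    from continuous_map_compose[OF this G(1)] show ?thesis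
      by (simp add: pathin_def o_def)
  qed
  have "G (0, 1) = G (0, 0)"
    by (rule path_with_constant_image[OF uniq Gv[of 0], of "g (p 0)"]) (use G L in auto)
  moreover have "G (1, 1) = G (1, 0)"
    by (rule path_with_constant_image[OF uniq Gv[of 1], of "g (p 0)"]) (use G L in auto)
  moreover have "G (1, 1) = G (0, 1)"
    by (rule path_with_constant_image[OF uniq Gh, of "g (p 0)"]) (use G L in auto)
  ultimately show ?thesis
    using G(2) by simp
qed

text \<open>The lift is read off from the pullback \<open>P\<close> of \<open>f\<close> and \<open>g\<close>: its value at \<open>z\<close> is the \<open>x\<close> for which
  \<open>(z, x)\<close> lies in the path component of \<open>(z0, x0)\<close>. Lifting paths of \<open>Z\<close> yields such an \<open>x\<close>. Two of
  them are joined by a path in \<open>P\<close> over a loop of \<open>Z\<close>, and lifts of loops are closed. Working with path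
  components of \<open>P\<close> replaces all concatenation of paths.\<close>

lemma lift_from_simply_connected:
  assumes lpcX: "locally_path_connected_space X" and f: "continuous_map X Y f" and pm: "peano_map X Y f"
    and hlp: "homotopy_lifting_property X Y f unit_interval"
    and uniq: "uniqueness_of_path_lifts X f"
    and lpcZ: "locally_path_connected_space Z" and Z: "simply_connected_space Z"
    and g: "continuous_map Z Y g" and z0: "z0 \<in> topspace Z" and x0: "x0 \<in> topspace X" "g z0 = f x0"
  obtains h where "continuous_map Z X h" "h z0 = x0" "\<And>z. z \<in> topspace Z \<Longrightarrow> f (h z) = g z"
proof -
  define P where "P = subtopology (prod_topology Z X) {(z, x). g z = f x}"
  have pathP: "pathin P w \<longleftrightarrow> pathin Z (\<lambda>t. fst (w t)) \<and> pathin X (\<lambda>t. snd (w t)) \<and>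
      (\<forall>t\<in>{0..1}. g (fst (w t)) = f (snd (w t)))" for w
    unfolding P_def pathin_subtopology
    by (auto simp: pathin_def continuous_map_pairwise o_def case_prod_unfold)
  let ?R = "\<lambda>z x. path_component_of P (z0, x0) (z, x)"
  have ex: "\<exists>x. ?R z x" if z: "z \<in> topspace Z" for z
  proof -
    obtain p where p: "pathin Z p" "p 0 = z0" "p 1 = z"
      using Z z0 z unfolding simply_connected_space_def path_connected_space_def by blast
    have "pathin Y (\<lambda>t. g (p t))"
      using pathin_compose[OF p(1) g] by (simp add: o_def)
    then obtain q where q: "pathin X q" "q 0 = x0" "\<And>t. t \<in> {0..1} \<Longrightarrow> f (q t) = g (p t)"
      using path_lift[OF hlp, of "\<lambda>t. g (p t)" x0] x0 p(2) by auto
    have "pathin P (\<lambda>t. (p t, q t))"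
      using p q by (simp add: pathP)
    then show ?thesis
      unfolding path_component_of_def using p q
      by (intro exI[of _ "q 1"] exI[of _ "\<lambda>t. (p t, q t)"]) simp
  qed
  have unique: "x = x'" if zx: "?R z x" "?R z x'" for z x x'
  proof -
    have "path_component_of P (z, x) (z, x')"
      by (rule path_component_of_trans[OF path_component_of_sym[OF zx(1)] zx(2)])
    then obtain w where w: "pathin P w" "w 0 = (z, x)" "w 1 = (z, x')"
      by (auto simp: path_component_of_def)
    then have "snd (w 1) = snd (w 0)"
      using loop_lift_closed[OF hlp uniq Z g, of "\<lambda>t. fst (w t)" "\<lambda>t. snd (w t)"]
      unfolding pathP by auto
    then show ?thesis
      using w by simp
  qed
  define h where "h z = (SOME x. ?R z x)" for z
  have h: "?R z (h z)" if "z \<in> topspace Z" for z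
    unfolding h_def by (rule someI_ex[OF ex[OF that]])
  have hX: "h z \<in> topspace X" "f (h z) = g z" if "z \<in> topspace Z" for z
    using path_component_in_topspace[OF h[OF that]] by (auto simp: P_def)
  have "(z0, x0) \<in> topspace P"
    using z0 x0 by (simp add: P_def)
  then have "h z0 = x0"
    using unique[OF h[OF z0]] path_component_of_refl[of P] by blast
  moreover have "continuous_map Z X h"
  proof (rule continuous_lift_if_continuous_on_paths[OF lpcX f pm lpcZ g])
    show "f (h z) = g z" if "z \<in> topspace Z" for z
      using hX that by blast
  next
    fix p assume p: "pathin Z p"
    have pZ: "p t \<in> topspace Z" if "t \<in> {0..1}" for t
      using p that path_image_subset_topspace by fastforce
    have "pathin Y (\<lambda>t. g (p t))"
      using pathin_compose[OF p(1) g] by (simp add: o_def)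
    then obtain q where q: "pathin X q" "q 0 = h (p 0)" "\<And>t. t \<in> {0..1} \<Longrightarrow> f (q t) = g (p t)"
      using path_lift[OF hlp, of "\<lambda>t. g (p t)" "h (p 0)"] hX pZ[of 0] by auto
    have "pathin P (\<lambda>t. (p t, q t))"
      using p q by (simp add: pathP)
    then have "path_component_of P (p 0, q 0) (p t, q t)" if "t \<in> {0..1}" for t
      using path_component_of_segment[of P _ 0 t] that by force
    then have "?R (p t) (q t)" if "t \<in> {0..1}" for t
      using path_component_of_trans[OF h[OF pZ[of 0]]] that q(2) by auto
    then have "q t = h (p t)" if "t \<in> {0..1}" for t
      using unique[OF _ h[OF pZ]] that by blast
    then show "pathin X (\<lambda>t. h (p t))"
      using q(1) unfolding pathin_def by (auto intro: continuous_map_eq)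
  qed
  ultimately show thesis
    using that hX by blast
qed

lemma lift_from_path_connected_unique:
  assumes "uniqueness_of_path_lifts X f" and "path_connected_space Z" and "z0 \<in> topspace Z"
    and "continuous_map Z X h" "continuous_map Z X h'" "h z0 = h' z0"
    and "\<And>z. z \<in> topspace Z \<Longrightarrow> f (h z) = f (h' z)" and "z \<in> topspace Z"
  shows "h z = h' z"
proof -
  obtain p where p: "pathin Z p" "p 0 = z0" "p 1 = z"
    using assms unfolding path_connected_space_def by blast
  have "pathin X (h \<circ> p)" "pathin X (h' \<circ> p)"
    using p assms pathin_compose by blast+
  moreover have "p t \<in> topspace Z" if "t \<in> {0..1}" for t
    using p(1) that path_image_subset_topspace by fastforce
  ultimately show ?thesis
    using assms(1)[unfolded uniqueness_of_path_lifts_def, rule_format, of "h \<circ> p" "h' \<circ> p" 1]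
      assms p by auto
qed

section \<open>Contractible spaces are simply connected\<close>

text \<open>A contraction \<open>c\<close> moves a loop freely to a point, while its base point \<open>z\<close> travels along the path
  \<open>t \<mapsto> c (t, z)\<close>. To keep the ends fixed, the loop is first deformed to one that travels along that path,
  waits at its end, and returns; this is then retracted along the path.\<close>

lemma contractible_imp_simply_connected_space:
  assumes "contractible_space Z"
  shows "simply_connected_space Z"
  unfolding simply_connected_space_def
proof (intro conjI allI impI)
  show "path_connected_space Z"
    using assms contractible_imp_path_connected_space by blast
next
  fix z p
  assume "pathin Z p \<and> p 0 = z \<and> p 1 = z"
  then have p: "continuous_map unit_interval Z p" "p 0 = z" "p 1 = z" "pathin Z p"
    by (auto simp: pathin_def)
  have pZ: "p s \<in> topspace Z" if "s \<in> {0..1}" for s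
    using p(1) that by (auto simp: continuous_map_def)
  then have z: "z \<in> topspace Z"
    using p(2) by force
  obtain c a where c: "continuous_map (prod_topology unit_interval Z) Z c"
    "\<And>x. c (0, x) = x" "\<And>x. c (1, x) = a"
    using assms unfolding contractible_space_def homotopic_with_def by auto
  have c_cont: "continuous_map (prod_topology unit_interval unit_interval) Z
      (\<lambda>w. c (\<phi> w, k w))"
    if \<phi>: "continuous_on ({0..1} \<times> {0..1}) \<phi>" "\<And>u s. u \<in> {0..1} \<Longrightarrow> s \<in> {0..1} \<Longrightarrow> \<phi> (u, s) \<in> {0..1}"
      and k: "continuous_map (prod_topology unit_interval unit_interval) Z k" for \<phi> k
  proof -
    have "continuous_map (prod_topology unit_interval unit_interval) unit_interval \<phi>"
      using \<phi> by auto
    from continuous_map_compose[OF continuous_map_pairedI[OF this k] c(1)]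
    show ?thesis
      unfolding o_def .
  qed
  \<comment> \<open>The position on the loop and the time of the contraction: the loop is run through in the middle
    third, when the contraction is complete.\<close>
  define \<xi> where "\<xi> s = min 1 (max 0 (3 * s - 1))" for s :: real
  define \<tau> where "\<tau> s = max 0 (min 1 (min (3 * s) (3 - 3 * s)))" for s :: real
  have \<tau>01: "\<tau> s \<in> {0..1}" and \<xi>01: "\<xi> s \<in> {0..1}" for s
    by (auto simp: \<tau>_def \<xi>_def)
  have \<tau>_cont: "continuous_on S (\<lambda>w. \<tau> (snd w))" and \<xi>_cont: "continuous_on S (\<lambda>w. \<xi> (snd w))" for S :: "(real \<times> real) set"
    unfolding \<tau>_def \<xi>_def by (intro continuous_intros)+
  have P_cong: "h 0 = z \<and> h 1 = z \<longleftrightarrow> k 0 = z \<and> k 1 = z"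
    if "\<And>x. x \<in> topspace unit_interval \<Longrightarrow> h x = k x" for h k :: "real \<Rightarrow> _"
    using that[of 0] that[of 1] by simp
  have conv: "(1 - u) * s + u * s' \<in> {0..1}" if "u \<in> {0..1}" "s \<in> {0..1}" "s' \<in> {0..1}" for u s s' :: real
    using that convex_bound_le[of s 1 s' "1 - u" u] by auto
  have "homotopic_with (\<lambda>q. q 0 = z \<and> q 1 = z) unit_interval Z p (\<lambda>s. c (\<tau> s, z))"
  proof (rule iffD2[OF homotopic_with], rule P_cong, assumption, intro exI conjI ballI)
    let ?\<phi> = "\<lambda>w. (1 - fst w) * snd w + fst w * \<xi> (snd w)"
    let ?Q = "\<lambda>w. c (fst w * \<tau> (snd w), p (?\<phi> w))"
    have "continuous_map (prod_topology unit_interval unit_interval) unit_interval ?\<phi>"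
      using conv \<xi>01 by (auto intro!: continuous_intros \<xi>_cont simp del: atLeastAtMost_iff)
    from continuous_map_compose[OF this p(1)]
    have "continuous_map (prod_topology unit_interval unit_interval) Z (\<lambda>w. p (?\<phi> w))"
      unfolding o_def .
    then show "continuous_map (prod_topology unit_interval unit_interval) Z ?Q"
      using \<tau>01 by (intro c_cont) (auto intro!: continuous_intros \<tau>_cont mult_le_one)
    show "?Q (0, s) = p s" for s
      by (simp add: c)
    show "?Q (1, s) = c (\<tau> s, z)" if "s \<in> topspace unit_interval" for s
    proof -
      consider "s \<le> 1/3" | "2/3 \<le> s" | "\<tau> s = 1"
        by (cases "s \<le> 1/3"; cases "2/3 \<le> s") (auto simp: \<tau>_def min_def max_def)
      then show ?thesis
        by cases (auto simp: \<xi>_def p c)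
    qed
    show "?Q (u, 0) = z" "?Q (u, 1) = z" for u
      by (simp_all add: \<tau>_def \<xi>_def c p)
  qed
  moreover have "homotopic_with (\<lambda>q. q 0 = z \<and> q 1 = z) unit_interval Z (\<lambda>s. c (\<tau> s, z)) (\<lambda>_. z)"
  proof (rule iffD2[OF homotopic_with], rule P_cong, assumption, intro exI conjI ballI)
    let ?Q = "\<lambda>w. c (min (\<tau> (snd w)) (1 - fst w), z)"
    show "continuous_map (prod_topology unit_interval unit_interval) Z ?Q"
      using \<tau>01 z by (intro c_cont) (auto intro!: continuous_intros \<tau>_cont simp: min_le_iff_disj)
    show "?Q (0, s) = c (\<tau> s, z)" for s
      using \<tau>01[of s] by (simp add: min_def)
    show "?Q (1, s) = z" for s
      using \<tau>01[of s] by (cases "\<tau> s = 0") (auto simp: c min_def)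
    show "?Q (u, 0) = z" "?Q (u, 1) = z" if "u \<in> {0..1}" for u
      using that by (simp_all add: \<tau>_def c min_def)
  qed
  ultimately show "homotopic_with (\<lambda>q. q 0 = z \<and> q 1 = z) unit_interval Z p (\<lambda>_. z)"
    using homotopic_with_trans by blast
qed

section \<open>The topology of hedgehogs\<close>

lemma hedgehog_spine:
  assumes "hedgehog S le Zs z0 Z" and "s \<in> S"
  obtains e where "homeomorphic_map unit_interval (Zs s) e" "e 0 = z0"
proof -
  have "\<forall>s\<in>S. \<exists>h. homeomorphic_map unit_interval (Zs s) h \<and> h 0 = z0"
    using assms(1) by (simp add: hedgehog_def)
  then show thesis
    using assms(2) that by blast
qed

lemma hedgehog_spines_meet_in_base:
  assumes "hedgehog S le Zs z0 Z" and "s \<in> S" "t \<in> S" "s \<noteq> t"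
  shows "topspace (Zs s) \<inter> topspace (Zs t) = {z0}"
proof -
  have "\<forall>s\<in>S. \<forall>t\<in>S. s \<noteq> t \<longrightarrow> topspace (Zs s) \<inter> topspace (Zs t) = {z0}"
    using assms(1) by (simp add: hedgehog_def)
  then show ?thesis
    using assms(2-) by blast
qed

lemma hedgehog_directed_set:
  "hedgehog S le Zs z0 Z \<Longrightarrow> directed_set S le"
  by (simp add: hedgehog_def)

lemma hedgehog_base_in_spine:
  assumes "hedgehog S le Zs z0 Z" and "s \<in> S"
  shows "z0 \<in> topspace (Zs s)"
proof -
  obtain e where "homeomorphic_map unit_interval (Zs s) e" "e 0 = z0"
    by (rule hedgehog_spine[OF assms])
  then show ?thesis
    using homeomorphic_imp_surjective_map[of unit_interval "Zs s" e] by force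
qed

lemma hedgehog_spine_path_connected:
  assumes "hedgehog S le Zs z0 Z" and "s \<in> S"
  shows "path_connected_space (Zs s)" and "locally_path_connected_space (Zs s)"
proof -
  obtain e where "homeomorphic_map unit_interval (Zs s) e"
    by (rule hedgehog_spine[OF assms])
  then have "unit_interval homeomorphic_space Zs s"
    using homeomorphic_map_imp_homeomorphic_space by blast
  then show "path_connected_space (Zs s)" and "locally_path_connected_space (Zs s)"
    using homeomorphic_path_connected_space[of unit_interval "Zs s"]
      homeomorphic_locally_path_connected_space[of unit_interval "Zs s"]
      locally_path_connected_real_interval(1)[of 0 1]

    by (auto simp: is_interval_path_connected is_interval_cc)
qed

lemma topspace_hedgehog:
  "hedgehog S le Zs z0 Z \<Longrightarrow> topspace Z = (\<Union>s\<in>S. topspace (Zs s))"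
  by (simp add: hedgehog_def)

lemma hedgehog_base_in_topspace:
  assumes "hedgehog S le Zs z0 Z"
  shows "z0 \<in> topspace Z"
proof -
  have "S \<noteq> {}"
    using hedgehog_directed_set[OF assms] by (simp add: directed_set_def)
  then show ?thesis
    using hedgehog_base_in_spine[OF assms] topspace_hedgehog[OF assms] by blast
qed

lemma openin_hedgehog_iff:
  assumes "hedgehog S le Zs z0 Z"
  shows "openin Z U \<longleftrightarrow> U \<subseteq> topspace Z \<and> (\<forall>s\<in>S. openin (Zs s) (U \<inter> topspace (Zs s))) \<and>
     (z0 \<in> U \<longrightarrow> (\<exists>t\<in>S. \<forall>s\<in>S. le t s \<and> \<not> le s t \<longrightarrow> topspace (Zs s) \<subseteq> U))"
proof (cases "U \<subseteq> topspace Z")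
  case True
  then show ?thesis
    using assms unfolding hedgehog_def by (cases "z0 \<in> U") (simp_all add: subset_Diff_insert conj_commute)
next
  case False
  then show ?thesis
    using openin_subset by blast
qed

lemma continuous_map_hedgehog_spine:
  assumes "hedgehog S le Zs z0 Z" and "s \<in> S"
  shows "continuous_map (Zs s) Z (\<lambda>z. z)"
proof -
  have "{z \<in> topspace (Zs s). z \<in> U} = U \<inter> topspace (Zs s)" for U
    by blast
  then show ?thesis
    using openin_hedgehog_iff[OF assms(1)] topspace_hedgehog[OF assms(1)] assms(2)
    by (auto simp: continuous_map_def)
qed

text \<open>Such a set meets no other spine.\<close>

lemma openin_hedgehog_off_base:
  assumes Z: "hedgehog S le Zs z0 Z" and s: "s \<in> S" and B: "openin (Zs s) B" and z0: "z0 \<notin> B"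
  shows "openin Z B"
proof -
  have B': "B \<subseteq> topspace (Zs s)"
    using B openin_subset by blast
  have "openin (Zs t) (B \<inter> topspace (Zs t))" if "t \<in> S" for t
  proof (cases "t = s")
    case True
    then show ?thesis
      using B B' by (simp add: Int_absorb2)
  next
    case False
    then have "topspace (Zs s) \<inter> topspace (Zs t) = {z0}"
      using hedgehog_spines_meet_in_base[OF Z s \<open>t \<in> S\<close>] by simp
    then have "B \<inter> topspace (Zs t) = {}"
      using B' z0 by auto
    then show ?thesis
      by simp
  qed
  then show ?thesis
    using B' s z0 topspace_hedgehog[OF Z] by (auto simp: openin_hedgehog_iff[OF Z])
qed

text \<open>A path component \<open>C\<close> of an open set \<open>U\<close> is open in each spine because spines are locally
  path-connected. If \<open>C\<close> contains the base point, then it contains every spine that lies in \<open>U\<close>, because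
  spines are path-connected.\<close>

lemma hedgehog_imp_locally_path_connected_space:
  assumes Z: "hedgehog S le Zs z0 Z"
  shows "locally_path_connected_space Z"
  unfolding locally_path_connected_space_open_path_components
proof (intro allI impI, elim conjE)
  fix U C
  assume U: "openin Z U" and C: "C \<in> path_components_of (subtopology Z U)"
  have CU: "C \<subseteq> U" "C \<subseteq> topspace Z"
    using path_components_of_subset[OF C] by auto
  have absorb: "D \<subseteq> C" if "s \<in> S" "path_connectedin (Zs s) D" "D \<subseteq> U" "D \<inter> C \<noteq> {}" for s D
  proof -
    have "path_connectedin Z ((\<lambda>z. z) ` D)"
      by (rule path_connectedin_continuous_map_image[OF continuous_map_hedgehog_spine[OF Z that(1)] that(2)])
    then have "path_connectedin (subtopology Z U) D"
      using that(3) by (simp add: path_connectedin_subtopology)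
    then show ?thesis
      using path_components_of_maximal[OF C] that(4) by (auto simp: disjnt_def)
  qed
  show "openin Z C"
    unfolding openin_hedgehog_iff[OF Z]
  proof (intro conjI ballI impI)
    show "C \<subseteq> topspace Z"
      by (rule CU)
  next
    fix s assume s: "s \<in> S"
    show "openin (Zs s) (C \<inter> topspace (Zs s))"
    proof (subst openin_subopen, intro ballI)
      fix z assume z: "z \<in> C \<inter> topspace (Zs s)"
      have "openin (Zs s) (U \<inter> topspace (Zs s))"
        using U s openin_hedgehog_iff[OF Z] by blast
      moreover have "z \<in> U \<inter> topspace (Zs s)"
        using z CU by blast
      ultimately obtain D where D: "openin (Zs s) D" "path_connectedin (Zs s) D" "z \<in> D"
        "D \<subseteq> U \<inter> topspace (Zs s)"
        using hedgehog_spine_path_connected(2)[OF Z s] unfolding locally_path_connected_space by blast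
      then show "\<exists>T. openin (Zs s) T \<and> z \<in> T \<and> T \<subseteq> C \<inter> topspace (Zs s)"
        using absorb[OF s D(2)] z by blast
    qed
  next
    assume "z0 \<in> C"
    then obtain t where t: "t \<in> S" "\<And>s. s \<in> S \<Longrightarrow> le t s \<and> \<not> le s t \<Longrightarrow> topspace (Zs s) \<subseteq> U"
      using U CU(1) openin_hedgehog_iff[OF Z, of U] by blast
    have "topspace (Zs s) \<subseteq> C" if "s \<in> S" "le t s \<and> \<not> le s t" for s
    proof (rule absorb[OF that(1) _ t(2)[OF that]])
      show "path_connectedin (Zs s) (topspace (Zs s))"
        using hedgehog_spine_path_connected(1)[OF Z that(1)] by (simp add: path_connectedin_topspace)
      show "topspace (Zs s) \<inter> C \<noteq> {}"
        using \<open>z0 \<in> C\<close> hedgehog_base_in_spine[OF Z that(1)] by blast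
    qed
    with t(1) show "\<exists>t\<in>S. \<forall>s\<in>S. le t s \<and> \<not> le s t \<longrightarrow> topspace (Zs s) \<subseteq> C"
      by blast
  qed
qed

lemma continuous_map_from_hedgehog:
  assumes Z: "hedgehog S le Zs z0 Z"
    and g: "\<And>s. s \<in> S \<Longrightarrow> continuous_map (Zs s) W g"
    and small: "\<And>V. openin W V \<Longrightarrow> g z0 \<in> V \<Longrightarrow>
      \<exists>t\<in>S. \<forall>s\<in>S. le t s \<and> \<not> le s t \<longrightarrow> g \<in> topspace (Zs s) \<rightarrow> V"
  shows "continuous_map Z W g"
  unfolding continuous_map_def
proof (intro conjI allI impI)
  have "g z \<in> topspace W" if "s \<in> S" "z \<in> topspace (Zs s)" for s z
    using g[OF that(1)] that(2) by (auto simp: continuous_map_def)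
  then show "g \<in> topspace Z \<rightarrow> topspace W"
    unfolding topspace_hedgehog[OF Z] by blast
next
  fix V assume V: "openin W V"
  have "{z \<in> topspace Z. g z \<in> V} \<inter> topspace (Zs s) = {z \<in> topspace (Zs s). g z \<in> V}" if "s \<in> S" for s
    using topspace_hedgehog[OF Z] that by blast
  then have "openin (Zs s) ({z \<in> topspace Z. g z \<in> V} \<inter> topspace (Zs s))" if "s \<in> S" for s
    using openin_continuous_map_preimage[OF g[OF that] V] that by simp
  moreover have "\<exists>t\<in>S. \<forall>s\<in>S. le t s \<and> \<not> le s t \<longrightarrow> topspace (Zs s) \<subseteq> {z \<in> topspace Z. g z \<in> V}"
    if z0: "z0 \<in> {z \<in> topspace Z. g z \<in> V}"
  proof -
    obtain t where t: "t \<in> S"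
      "\<And>s. s \<in> S \<Longrightarrow> le t s \<and> \<not> le s t \<Longrightarrow> g \<in> topspace (Zs s) \<rightarrow> V"
      using small[OF V] z0 by blast
    show ?thesis
      using t(2) topspace_hedgehog[OF Z] by (intro bexI[OF _ t(1)]) auto
  qed
  ultimately show "openin Z {z \<in> topspace Z. g z \<in> V}"
    unfolding openin_hedgehog_iff[OF Z] by simp
qed

text \<open>At a point off the base point the product is locally that of \<open>T\<close> with a spine. At the base point the
  tube lemma, in the form that the projection along the compact factor is closed, gives a neighbourhood
  of the base point in each spine, and on all late spines there is nothing to choose.\<close>

lemma continuous_map_from_compact_times_hedgehog:
  assumes Z: "hedgehog S le Zs z0 Z" and T: "compact_space T"
    and F: "\<And>s. s \<in> S \<Longrightarrow> continuous_map (prod_topology T (Zs s)) W F"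
    and base: "\<And>t. t \<in> topspace T \<Longrightarrow> F (t, z0) = y"
    and small: "\<And>V. openin W V \<Longrightarrow> y \<in> V \<Longrightarrow>
      \<exists>t\<in>S. \<forall>s\<in>S. le t s \<and> \<not> le s t \<longrightarrow> F \<in> topspace T \<times> topspace (Zs s) \<rightarrow> V"
  shows "continuous_map (prod_topology T Z) W F"
  unfolding continuous_map_def
proof (intro conjI allI impI)
  have "F (t, z) \<in> topspace W" if "s \<in> S" "z \<in> topspace (Zs s)" "t \<in> topspace T" for s z t
    using F[OF that(1)] that(2,3) by (auto simp: continuous_map_def)
  then show "F \<in> topspace (prod_topology T Z) \<rightarrow> topspace W"
    using topspace_hedgehog[OF Z] by auto
next
  fix V assume V: "openin W V"
  let ?P = "{w \<in> topspace (prod_topology T Z). F w \<in> V}"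
  have Ps: "openin (prod_topology T (Zs s)) {w \<in> topspace (prod_topology T (Zs s)). F w \<in> V}" if "s \<in> S" for s
    using openin_continuous_map_preimage[OF F[OF that] V] .
  have spine_subset: "topspace (Zs s) \<subseteq> topspace Z" if "s \<in> S" for s
    using topspace_hedgehog[OF Z] that by blast
  have at_base: "\<exists>A B. openin T A \<and> openin Z B \<and> t \<in> A \<and> z0 \<in> B \<and> A \<times> B \<subseteq> ?P"
    if t: "t \<in> topspace T" "F (t, z0) \<in> V" for t
  proof -
    let ?N = "{x \<in> topspace Z. \<forall>u\<in>topspace T. F (u, x) \<in> V}"
    have yV: "y \<in> V"
      using base t by simp
    have N_spine: "openin (Zs s) (?N \<inter> topspace (Zs s))" if s: "s \<in> S" for s
    proof -
      let ?C = "topspace (prod_topology T (Zs s)) - {w \<in> topspace (prod_topology T (Zs s)). F w \<in> V}"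
      have "closedin (prod_topology T (Zs s)) ?C"
        by (rule closedin_diff[OF closedin_topspace Ps[OF s]])
      then have "closedin (Zs s) (snd ` ?C)"
        using Abstract_Topological_Spaces.closed_map_snd[OF T, of "Zs s"] unfolding closed_map_def by simp
      moreover have "?N \<inter> topspace (Zs s) = topspace (Zs s) - snd ` ?C"
      proof
        show "?N \<inter> topspace (Zs s) \<subseteq> topspace (Zs s) - snd ` ?C"
          by auto
        show "topspace (Zs s) - snd ` ?C \<subseteq> ?N \<inter> topspace (Zs s)"
        proof
          fix x assume x: "x \<in> topspace (Zs s) - snd ` ?C"
          have "F (u, x) \<in> V" if "u \<in> topspace T" for u
          proof (rule ccontr)
            assume "F (u, x) \<notin> V"
            then have "(u, x) \<in> ?C"
              using x that by simp
            then have "snd (u, x) \<in> snd ` ?C"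
              by (rule imageI)
            with x show False
              by simp
          qed
          then show "x \<in> ?N \<inter> topspace (Zs s)"
            using x spine_subset[OF s] by auto
        qed
      qed
      ultimately show ?thesis
        by (simp add: openin_diff)
    qed
    obtain t' where t': "t' \<in> S"
      "\<And>s. s \<in> S \<Longrightarrow> le t' s \<and> \<not> le s t' \<Longrightarrow> F \<in> topspace T \<times> topspace (Zs s) \<rightarrow> V"
      using small[OF V yV] by blast
    have "topspace (Zs s) \<subseteq> ?N" if "s \<in> S" "le t' s \<and> \<not> le s t'" for s
      using t'(2)[OF that] spine_subset[OF that(1)] by auto
    then have "openin Z ?N"
      unfolding openin_hedgehog_iff[OF Z] using N_spine t'(1) by auto
    moreover have "z0 \<in> ?N"
      using base yV hedgehog_base_in_topspace[OF Z] by simp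
    ultimately show ?thesis
      using t(1) by (intro exI[of _ "topspace T"] exI[of _ ?N]) auto
  qed
  have off_base: "\<exists>A B. openin T A \<and> openin Z B \<and> t \<in> A \<and> z \<in> B \<and> A \<times> B \<subseteq> ?P"
    if t: "t \<in> topspace T" "F (t, z) \<in> V" and s: "s \<in> S" "z \<in> topspace (Zs s)" and "z \<noteq> z0" for t z s
  proof -
    have "(t, z) \<in> {w \<in> topspace (prod_topology T (Zs s)). F w \<in> V}"
      using t s by simp
    with Ps[OF s(1)] obtain A B where AB: "openin T A" "openin (Zs s) B" "t \<in> A" "z \<in> B"
      "A \<times> B \<subseteq> {w \<in> topspace (prod_topology T (Zs s)). F w \<in> V}"
      unfolding openin_prod_topology_alt by meson
    obtain e where "homeomorphic_map unit_interval (Zs s) e"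
      by (rule hedgehog_spine[OF Z s(1)])
    then have "unit_interval homeomorphic_space Zs s"
      by (rule homeomorphic_map_imp_homeomorphic_space)
    then have "Hausdorff_space (Zs s)"
      using homeomorphic_Hausdorff_space[of unit_interval "Zs s"]
      by (simp add: Hausdorff_space_subtopology Hausdorff_space_euclidean)
    then have "closedin (Zs s) {z0}"
      by (rule closedin_Hausdorff_singleton[OF _ hedgehog_base_in_spine[OF Z s(1)]])
    with AB(2) have "openin (Zs s) (B - {z0})"
      by (rule openin_diff)
    then have "openin Z (B - {z0})"
      by (rule openin_hedgehog_off_base[OF Z s(1)]) simp
    moreover have "A \<times> (B - {z0}) \<subseteq> ?P"
      using AB(5) spine_subset[OF s(1)] by auto
    ultimately show ?thesis
      using AB \<open>z \<noteq> z0\<close> by (intro exI[of _ A] exI[of _ "B - {z0}"]) simp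
  qed
  have "\<exists>A B. openin T A \<and> openin Z B \<and> t \<in> A \<and> z \<in> B \<and> A \<times> B \<subseteq> ?P" if tz: "(t, z) \<in> ?P" for t z
  proof -
    have "t \<in> topspace T" "F (t, z) \<in> V" "z \<in> topspace Z"
      using tz by simp_all
    moreover then obtain s where "s \<in> S" "z \<in> topspace (Zs s)"
      using topspace_hedgehog[OF Z] by auto
    ultimately show ?thesis
      using at_base[of t] off_base[of t z s] by (cases "z = z0") simp_all
  qed
  then show "openin (prod_topology T Z) ?P"
    unfolding openin_prod_topology_alt by blast
qed

text \<open>Shrink all spines simultaneously. The base point stays where it is, and each spine is mapped into
  itself, which gives the smallness on late spines.\<close>

lemma hedgehog_pointed_contraction:
  assumes Z: "hedgehog S le Zs z0 Z"
  shows "homotopic_with (\<lambda>k. k z0 = z0) Z Z id (\<lambda>_. z0)"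
proof -
  have "\<forall>s\<in>S. \<exists>e d. homeomorphic_maps unit_interval (Zs s) e d \<and> e 0 = z0"
    using hedgehog_spine[OF Z] unfolding homeomorphic_map_maps by metis
  then obtain e d where ed: "\<And>s. s \<in> S \<Longrightarrow> homeomorphic_maps unit_interval (Zs s) (e s) (d s)"
    and e0: "\<And>s. s \<in> S \<Longrightarrow> e s 0 = z0"
    unfolding bchoice_iff by blast
  have e: "continuous_map unit_interval (Zs s) (e s)" and d: "continuous_map (Zs s) unit_interval (d s)"
    and ed_id: "\<And>z. z \<in> topspace (Zs s) \<Longrightarrow> e s (d s z) = z" and d0: "d s z0 = 0" if "s \<in> S" for s
    using ed[OF that] e0[OF that] by (auto simp: homeomorphic_maps_def)
  have d01: "d s z \<in> {0..1}" if "s \<in> S" "z \<in> topspace (Zs s)" for s z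
    using d[OF that(1)] that(2) by (auto simp: continuous_map_def)
  \<comment> \<open>Any spine through \<open>z\<close> may be used: only the base point is on several, and all of them fix it.\<close>
  define \<sigma> where "\<sigma> z = (SOME s. s \<in> S \<and> z \<in> topspace (Zs s))" for z
  define c where "c = (\<lambda>(t, z). e (\<sigma> z) ((1 - t) * d (\<sigma> z) z))"
  have c_spine: "c (t, z) = e s ((1 - t) * d s z)" if s: "s \<in> S" "z \<in> topspace (Zs s)" for s t z
  proof -
    have \<sigma>: "\<sigma> z \<in> S \<and> z \<in> topspace (Zs (\<sigma> z))"
      unfolding \<sigma>_def by (rule someI) (use s in blast)
    moreover have "z = z0" if "\<sigma> z \<noteq> s"
      using hedgehog_spines_meet_in_base[OF Z conjunct1[OF \<sigma>] s(1) that] \<sigma> s(2) by auto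
    ultimately show ?thesis
      using s e0 d0 unfolding c_def by (cases "\<sigma> z = s") auto
  qed
  have scaled: "(1 - t) * r \<in> {0..1}" if "t \<in> {0..1}" "r \<in> {0..1}" for t r :: real
    using that by (auto simp: mult_le_one)
  have c_cont: "continuous_map (prod_topology unit_interval (Zs s)) (Zs s) c" if s: "s \<in> S" for s
  proof -
    have d': "continuous_map (prod_topology unit_interval (Zs s)) unit_interval (\<lambda>w. d s (snd w))"
      using continuous_map_compose[OF continuous_map_snd d[OF s]] by (simp add: o_def)
    have "continuous_map (prod_topology unit_interval (Zs s)) unit_interval (\<lambda>w. (1 - fst w) * d s (snd w))"
    proof (rule continuous_map_into_unit_interval)
      show "continuous_map (prod_topology unit_interval (Zs s)) euclideanreal (\<lambda>w. (1 - fst w) * d s (snd w))"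
        by (intro continuous_map_real_mult continuous_map_diff continuous_map_const[THEN iffD2]
            continuous_map_real_of_unit_interval[OF d'] continuous_map_real_of_unit_interval[OF continuous_map_fst]) auto
      show "0 \<le> (1 - fst w) * d s (snd w) \<and> (1 - fst w) * d s (snd w) \<le> 1"
        if "w \<in> topspace (prod_topology unit_interval (Zs s))" for w
        using scaled[of "fst w" "d s (snd w)"] d01[OF s] that by auto
    qed
    from continuous_map_compose[OF this e[OF s]] show ?thesis
      by (rule continuous_map_eq) (use c_spine[OF s] in auto)
  qed
  have c_image: "c \<in> {0..1} \<times> topspace (Zs s) \<rightarrow> topspace (Zs s)" if "s \<in> S" for s
    using c_cont[OF that] by (simp add: continuous_map_def)
  have c_base: "c (t, z0) = z0" for t
  proof -
    obtain s where "s \<in> S"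
      using hedgehog_directed_set[OF Z] by (auto simp: directed_set_def)
    then show ?thesis
      using c_spine hedgehog_base_in_spine[OF Z] d0 e0 by simp
  qed
  have c: "continuous_map (prod_topology unit_interval Z) Z c"
  proof (rule continuous_map_from_compact_times_hedgehog[OF Z, where y = z0])
    show "compact_space unit_interval"
      by (simp add: compact_space_subtopology)
    show "continuous_map (prod_topology unit_interval (Zs s)) Z c" if "s \<in> S" for s
      using continuous_map_compose[OF c_cont[OF that] continuous_map_hedgehog_spine[OF Z that]]
      by (simp add: o_def)
    show "c (t, z0) = z0" for t
      by (rule c_base)
    show "\<exists>t\<in>S. \<forall>s\<in>S. le t s \<and> \<not> le s t \<longrightarrow> c \<in> topspace unit_interval \<times> topspace (Zs s) \<rightarrow> V"
      if V: "openin Z V" "z0 \<in> V" for V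
    proof -
      have "\<exists>t\<in>S. \<forall>s\<in>S. le t s \<and> \<not> le s t \<longrightarrow> topspace (Zs s) \<subseteq> V"
        using V openin_hedgehog_iff[OF Z, of V] by simp
      then obtain t where t: "t \<in> S" "\<And>s. s \<in> S \<Longrightarrow> le t s \<and> \<not> le s t \<Longrightarrow> topspace (Zs s) \<subseteq> V"
        by blast
      have "c \<in> topspace unit_interval \<times> topspace (Zs s) \<rightarrow> V" if "s \<in> S" "le t s \<and> \<not> le s t" for s
        using c_image[OF that(1)] t(2)[OF that] by auto
      with t(1) show ?thesis
        by blast
    qed
  qed
  show ?thesis
  proof (rule iffD2[OF homotopic_with], use hedgehog_base_in_topspace[OF Z] in simp, intro exI conjI ballI)
    show "continuous_map (prod_topology unit_interval Z) Z c"
      by (rule c)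
    fix z assume "z \<in> topspace Z"
    then obtain s where s: "s \<in> S" "z \<in> topspace (Zs s)"
      using topspace_hedgehog[OF Z] by blast
    show "c (0, z) = id z" "c (1, z) = z0"
      using c_spine[OF s] ed_id[OF s] e0[OF s(1)] by auto
  qed (rule c_base)
qed

lemma hedgehog_imp_contractible_space:
  assumes "hedgehog S le Zs z0 Z"
  shows "contractible_space Z"
  using homotopic_with_mono[OF hedgehog_pointed_contraction[OF assms], of "\<lambda>_. True"]
  unfolding contractible_space_def by blast

lemma hedgehog_imp_peano_space:
  assumes "hedgehog S le Zs z0 Z"
  shows "peano_space Z"
  using hedgehog_imp_locally_path_connected_space[OF assms]
    contractible_imp_connected_space[OF hedgehog_imp_contractible_space[OF assms]]
  by (simp add: peano_space_def)

lemma homeomorphic_copy: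
  assumes "inj_on e (topspace K)"
  obtains Z where "homeomorphic_map K Z e"
proof -
  let ?Z = "pullback_topology (e ` topspace K) (inv_into (topspace K) e) K"
  have preimage: "inv_into (topspace K) e -` U \<inter> e ` topspace K = e ` U" if "U \<subseteq> topspace K" for U
  proof -
    have "inv_into (topspace K) e (e x) = x" if "x \<in> topspace K" for x
      using that assms by (rule inv_into_f_f[rotated])
    with that show ?thesis
      by (auto simp: image_iff)
  qed
  have openZ: "openin ?Z W \<longleftrightarrow> (\<exists>U. openin K U \<and> W = e ` U)" for W
    unfolding openin_pullback_topology using preimage openin_subset by metis
  have topZ: "topspace ?Z = e ` topspace K"
    unfolding topspace_pullback_topology by (rule preimage) simp
  have "continuous_map K ?Z e"
    unfolding continuous_map_def
  proof (intro conjI allI impI)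
    show "e \<in> topspace K \<rightarrow> topspace ?Z"
      by (simp add: topZ)
    fix W assume "openin ?Z W"
    then obtain U where U: "openin K U" "W = e ` U"
      using openZ by blast
    then have "{x \<in> topspace K. e x \<in> W} = U"
      using assms openin_subset[OF U(1)] by (auto simp: inj_on_def)
    with U show "openin K {x \<in> topspace K. e x \<in> W}"
      by simp
  qed
  moreover have "open_map K ?Z e"
    unfolding open_map_def openZ by blast
  ultimately show thesis
    using that assms topZ bijective_open_imp_homeomorphic_map by metis
qed

text \<open>The two clauses that define open sets give a topology because the index set is directed, so that
  two tails contain a common one.\<close>

lemma hedgehog_exists:
  assumes S: "directed_set S le"
    and "\<And>s. s \<in> S \<Longrightarrow> \<exists>h. homeomorphic_map unit_interval (Zs s) h \<and> h 0 = z0"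
    and "\<And>s t. s \<in> S \<Longrightarrow> t \<in> S \<Longrightarrow> s \<noteq> t \<Longrightarrow> topspace (Zs s) \<inter> topspace (Zs t) = {z0}"
  obtains Z where "hedgehog S le Zs z0 Z"
proof -
  let ?T = "\<Union>s\<in>S. topspace (Zs s)"
  let ?eventually = "\<lambda>U. \<exists>t\<in>S. \<forall>s\<in>S. le t s \<and> \<not> le s t \<longrightarrow> topspace (Zs s) \<subseteq> U"
  let ?open = "\<lambda>U. U \<subseteq> ?T \<and> (\<forall>s\<in>S. openin (Zs s) (U \<inter> topspace (Zs s))) \<and> (z0 \<in> U \<longrightarrow> ?eventually U)"
  have eventually_Int: "?eventually (U \<inter> V)" if UV: "?eventually U" "?eventually V" for U V
  proof -
    obtain a b where a: "a \<in> S" "\<And>s. s \<in> S \<Longrightarrow> le a s \<and> \<not> le s a \<Longrightarrow> topspace (Zs s) \<subseteq> U"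
      and b: "b \<in> S" "\<And>s. s \<in> S \<Longrightarrow> le b s \<and> \<not> le s b \<Longrightarrow> topspace (Zs s) \<subseteq> V"
      using UV by blast
    obtain c where c: "c \<in> S" "le a c" "le b c"
      using S a(1) b(1) unfolding directed_set_def by blast
    have trans: "le x z" if "le x y" "le y z" "x \<in> S" "y \<in> S" "z \<in> S" for x y z
      using S that unfolding directed_set_def transp_on_def by blast
    have "topspace (Zs s) \<subseteq> U \<inter> V" if s: "s \<in> S" "le c s \<and> \<not> le s c" for s
    proof -
      have "le a s \<and> \<not> le s a" "le b s \<and> \<not> le s b"
        using trans s a(1) b(1) c by blast+
      then show ?thesis
        using a(2)[OF s(1)] b(2)[OF s(1)] by blast
    qed
    with c(1) show ?thesis
      by blast
  qed
  have "istopology ?open"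
    unfolding istopology_def
  proof (intro conjI allI impI)
    fix U V assume U: "?open U" and V: "?open V"
    show "\<forall>s\<in>S. openin (Zs s) (U \<inter> V \<inter> topspace (Zs s))"
    proof
      fix s assume "s \<in> S"
      then have "openin (Zs s) ((U \<inter> topspace (Zs s)) \<inter> (V \<inter> topspace (Zs s)))"
        using openin_Int[of "Zs s" "U \<inter> topspace (Zs s)" "V \<inter> topspace (Zs s)"] U V by blast
      moreover have "(U \<inter> topspace (Zs s)) \<inter> (V \<inter> topspace (Zs s)) = U \<inter> V \<inter> topspace (Zs s)"
        by blast
      ultimately show "openin (Zs s) (U \<inter> V \<inter> topspace (Zs s))"
        by simp
    qed
    show "U \<inter> V \<subseteq> ?T"
      using U by blast
    show "?eventually (U \<inter> V)" if "z0 \<in> U \<inter> V"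
      using eventually_Int[of U V] U V that by simp
  next
    fix \<U> assume \<U>: "\<forall>U\<in>\<U>. ?open U"
    show "\<Union>\<U> \<subseteq> ?T"
      using \<U> by blast
    have "\<Union>\<U> \<inter> A = (\<Union>U\<in>\<U>. U \<inter> A)" for A
      by blast
    moreover have "openin (Zs s) (\<Union>U\<in>\<U>. U \<inter> topspace (Zs s))" if "s \<in> S" for s
      using \<U> that by (intro openin_Union) blast
    ultimately show "\<forall>s\<in>S. openin (Zs s) (\<Union>\<U> \<inter> topspace (Zs s))"
      by simp
    assume "z0 \<in> \<Union>\<U>"
    then obtain U where U: "U \<in> \<U>" "z0 \<in> U"
      by blast
    then have "?eventually U"
      using \<U> by blast
    then obtain t where t: "t \<in> S" "\<And>s. s \<in> S \<Longrightarrow> le t s \<and> \<not> le s t \<Longrightarrow> topspace (Zs s) \<subseteq> U"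
      by blast
    show "?eventually (\<Union>\<U>)"
      using t(2) U(1) by (intro bexI[OF _ t(1)]) blast
  qed
  then have open_iff: "openin (topology ?open) U \<longleftrightarrow> ?open U" for U
    by (simp add: topology_inverse')
  have "openin (Zs s) (?T \<inter> topspace (Zs s))" if "s \<in> S" for s
  proof -
    have "?T \<inter> topspace (Zs s) = topspace (Zs s)"
      using that by blast
    then show ?thesis
      by simp
  qed
  moreover have "?eventually ?T"
    using S unfolding directed_set_def by blast
  ultimately have "openin (topology ?open) ?T"
    unfolding open_iff by blast
  then have topZ: "topspace (topology ?open) = ?T"
    by (metis (no_types, lifting) open_iff openin_subset openin_topspace subset_antisym)
  have "hedgehog S le Zs z0 (topology ?open)"
    unfolding hedgehog_def topZ open_iff using assms by auto
  then show thesis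
    by (rule that)
qed

text \<open>With a single index no spine is strictly later than another, and the clause on late spines is void.\<close>

lemma unit_interval_copy_hedgehog:
  assumes "homeomorphic_map unit_interval Z h"
  shows "hedgehog {s} (\<lambda>_ _. True) (\<lambda>_. Z) (h 0) Z"
proof -
  have "h 0 \<in> topspace Z"
    using homeomorphic_imp_surjective_map[OF assms] by force
  moreover have "U \<inter> topspace Z = U" if "U \<subseteq> topspace Z" for U
    using that by blast
  moreover have "directed_set {s} (\<lambda>_ _. True)"
    by (auto simp: directed_set_def reflp_on_def transp_on_def)
  ultimately show ?thesis
    using assms unfolding hedgehog_def by (auto simp: subset_Diff_insert)
qed

section \<open>Hedgehogs detect Peano maps\<close>

text \<open>Run the contraction backwards, from the constant map to the identity, and lift the resulting homotopy
  from the constant map at \<open>x0\<close>. The base point has a constant track, so by uniqueness its lift does not move.\<close>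

lemma lift_from_hedgehog:
  assumes Z: "hedgehog S le Zs z0 Z" and hlp: "homotopy_lifting_property X Y f Z"
    and uniq: "uniqueness_of_path_lifts X f"
    and g: "continuous_map Z Y g" and x0: "x0 \<in> topspace X" "g z0 = f x0"
  shows "\<exists>h. continuous_map Z X h \<and> h z0 = x0 \<and> (\<forall>z\<in>topspace Z. f (h z) = g z)"
proof -
  obtain c where c: "continuous_map (prod_topology unit_interval Z) Z c"
    "\<And>z. c (0, z) = z" "\<And>z. c (1, z) = z0" "\<And>t. t \<in> {0..1} \<Longrightarrow> c (t, z0) = z0"
    using hedgehog_pointed_contraction[OF Z] unfolding homotopic_with_def by auto
  have snd1: "continuous_map (prod_topology Z unit_interval) unit_interval (\<lambda>w. 1 - snd w)"
  proof (rule continuous_map_into_unit_interval)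
    show "continuous_map (prod_topology Z unit_interval) euclideanreal (\<lambda>w. 1 - snd w)"
      by (intro continuous_map_diff continuous_map_real_of_unit_interval[OF continuous_map_snd]) simp
  qed auto
  from continuous_map_compose[OF continuous_map_compose[OF continuous_map_pairedI[OF snd1 continuous_map_fst] c(1)] g]
  have H: "continuous_map (prod_topology Z unit_interval) Y (\<lambda>w. g (c (1 - snd w, fst w)))"
    by (simp add: o_def)
  have const: "continuous_map Z X (\<lambda>_. x0)"
    using x0 by simp
  obtain G where G: "continuous_map (prod_topology Z unit_interval) X G"
    "\<And>z. z \<in> topspace Z \<Longrightarrow> G (z, 0) = x0"
    "\<And>z t. z \<in> topspace Z \<Longrightarrow> t \<in> {0..1} \<Longrightarrow> f (G (z, t)) = g (c (1 - t, z))"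
    using homotopy_lift[OF hlp const H] c(3) x0 by auto
  have z0: "z0 \<in> topspace Z"
    by (rule hedgehog_base_in_topspace[OF Z])
  have "continuous_map Z (prod_topology Z unit_interval) (\<lambda>z. (z, 1))"
    by (simp add: continuous_map_pairedI)
  from continuous_map_compose[OF this G(1)] have "continuous_map Z X (\<lambda>z. G (z, 1))"
    by (simp add: o_def)
  moreover have "G (z0, 1) = x0"
  proof -
    have "pathin X (\<lambda>t. G (z0, t))"
      using continuous_map_o_Pair[OF G(1) z0] by (simp add: pathin_def o_def)
    from path_with_constant_image[OF uniq this, of "g z0" 1] show ?thesis
      using G(2,3)[OF z0] c(4) by simp
  qed
  ultimately show ?thesis
    using G(3) c(2) by (intro exI[of _ "\<lambda>z. G (z, 1)"]) simp
qed

text \<open>Suppose that for some neighbourhood \<open>V\<close> of \<open>x0\<close> every neighbourhood \<open>U\<close> of \<open>f x0\<close> admits a path that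
  starts at \<open>x0\<close>, leaves \<open>V\<close>, and has its image in \<open>U\<close>. The images of these paths are the spines of a
  map from a hedgehog, indexed by the neighbourhoods \<open>U\<close>, that is continuous because the spines shrink to
  \<open>f x0\<close>. A lift must follow the given paths by uniqueness, so the tip of every spine is sent outside \<open>V\<close>.
  But continuity of the lift at the base point puts the late spines inside \<open>V\<close>.\<close>

lemma peano_map_if_lifts_from_hedgehogs:
  fixes X :: "'a topology" and Y :: "'b topology"
  assumes lpcX: "locally_path_connected_space X" and f: "continuous_map X Y f"
    and uniq: "uniqueness_of_path_lifts X f"
    and lift: "\<And>(S :: 'b test_point set) le (Zs :: 'b test_point \<Rightarrow> 'b test_point topology) z0 Z g x0.
      hedgehog S le Zs z0 Z \<Longrightarrow> continuous_map Z Y g \<Longrightarrow> x0 \<in> topspace X \<Longrightarrow> g z0 = f x0 \<Longrightarrow>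
      \<exists>h. continuous_map Z X h \<and> h z0 = x0 \<and> (\<forall>z\<in>topspace Z. f (h z) = g z)"
  shows "peano_map X Y f"
  unfolding peano_map_iff[OF f lpcX]
proof (rule ccontr)
  let ?F = "\<lambda>U. subtopology X {x \<in> topspace X. f x \<in> U}"
  assume "\<not> (\<forall>V x. openin X V \<and> x \<in> V \<longrightarrow> (\<exists>U. openin Y U \<and> f x \<in> U \<and>
    Collect (path_component_of (?F U) x) \<subseteq> V))"
  then obtain V x0 where V: "openin X V" "x0 \<in> V"
    and escape: "\<And>U. openin Y U \<Longrightarrow> f x0 \<in> U \<Longrightarrow> \<not> Collect (path_component_of (?F U) x0) \<subseteq> V"
    by blast
  have x0: "x0 \<in> topspace X"
    using V openin_subset by blast
  define \<N> where "\<N> = {U. openin Y U \<and> f x0 \<in> U}"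
  have "\<exists>q. pathin X q \<and> q 0 = x0 \<and> q 1 \<notin> V \<and> (\<forall>t\<in>{0..1}. f (q t) \<in> U)" if U: "U \<in> \<N>" for U
  proof -
    obtain x where x: "path_component_of (?F U) x0 x" "x \<notin> V"
      using escape[of U] U by (auto simp: \<N>_def)
    then obtain q where "pathin (?F U) q" "q 0 = x0" "q 1 = x"
      unfolding path_component_of_def by blast
    with x(2) show ?thesis
      by (intro exI[of _ q]) (auto simp: pathin_subtopology)
  qed
  then have "\<forall>U\<in>\<N>. \<exists>q. pathin X q \<and> q 0 = x0 \<and> q 1 \<notin> V \<and> (\<forall>t\<in>{0..1}. f (q t) \<in> U)"
    by blast
  from bchoice[OF this] obtain q where q: "\<And>U. U \<in> \<N> \<Longrightarrow> pathin X (q U)"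
    "\<And>U. U \<in> \<N> \<Longrightarrow> q U 0 = x0" "\<And>U. U \<in> \<N> \<Longrightarrow> q U 1 \<notin> V"
    "\<And>U t. U \<in> \<N> \<Longrightarrow> t \<in> {0..1} \<Longrightarrow> f (q U t) \<in> U"
    by blast
  \<comment> \<open>The natural number ensures that no index is maximal: the neighbourhoods of \<open>f x0\<close> alone may
    have a least element, and no spine would be later than that one.\<close>
  define S :: "'b test_point set" where "S = (\<lambda>p. (p, \<lambda>_. 0)) ` (\<N> \<times> UNIV)"
  define le :: "'b test_point \<Rightarrow> 'b test_point \<Rightarrow> bool"
    where "le s t \<longleftrightarrow> fst (fst t) \<subseteq> fst (fst s) \<and> snd (fst s) \<le> snd (fst t)" for s t
  define z0 :: "'b test_point" where "z0 = (({}, 0), \<lambda>_. 0)"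
  define e :: "'b test_point \<Rightarrow> real \<Rightarrow> 'b test_point"
    where "e s r = (if r = 0 then z0 else (fst s, \<lambda>_. r))" for s r
  have SN: "fst (fst s) \<in> \<N>" if "s \<in> S" for s
    using that by (auto simp: S_def)
  have inj: "inj_on (e s) {0..1}" for s
    by (auto simp: inj_on_def e_def z0_def fun_eq_iff)
  have "\<exists>Zs. homeomorphic_map unit_interval Zs (e s)" for s
    by (rule homeomorphic_copy[of "e s" unit_interval]) (use inj in auto)
  then obtain Zs where Zs: "\<And>s. homeomorphic_map unit_interval (Zs s) (e s)"
    by metis
  have topZs: "topspace (Zs s) = e s ` {0..1}" for s
    using homeomorphic_imp_surjective_map[OF Zs] by simp
  have directed: "directed_set S le"
    unfolding directed_set_def
  proof (intro conjI ballI)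
    have "topspace Y \<in> \<N>"
      using f x0 by (auto simp: \<N>_def continuous_map_def)
    then show "S \<noteq> {}"
      by (auto simp: S_def)
    show "reflp_on S le" "transp_on S le"
      by (auto simp: reflp_on_def transp_on_def le_def)
    fix a b assume "a \<in> S" "b \<in> S"
    then obtain A m B n where "a = ((A, m), \<lambda>_. 0)" "b = ((B, n), \<lambda>_. 0)" "A \<in> \<N>" "B \<in> \<N>"
      by (auto simp: S_def)
    moreover from this have "((A \<inter> B, max m n), \<lambda>_. 0) \<in> S"
      by (auto simp: S_def \<N>_def)
    ultimately show "\<exists>c\<in>S. le a c \<and> le b c"
      by (intro bexI[of _ "((A \<inter> B, max m n), \<lambda>_. 0)"]) (auto simp: le_def)
  qed
  have meet: "topspace (Zs s) \<inter> topspace (Zs t) = {z0}" if st: "s \<in> S" "t \<in> S" "s \<noteq> t" for s t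
  proof
    show "{z0} \<subseteq> topspace (Zs s) \<inter> topspace (Zs t)"
      unfolding topZs by (auto simp: e_def image_iff intro!: bexI[of _ 0])
    have "fst s \<noteq> fst t"
      using st by (auto simp: S_def)
    then show "topspace (Zs s) \<inter> topspace (Zs t) \<subseteq> {z0}"
      unfolding topZs by (auto simp: e_def split: if_splits)
  qed
  obtain Z where Z: "hedgehog S le Zs z0 Z"
  proof (rule hedgehog_exists[OF directed])
    show "\<exists>h. homeomorphic_map unit_interval (Zs s) h \<and> h 0 = z0" for s
      using Zs[of s] by (intro exI[of _ "e s"]) (simp add: e_def)
    show "topspace (Zs s) \<inter> topspace (Zs t) = {z0}" if "s \<in> S" "t \<in> S" "s \<noteq> t" for s t
      by (rule meet[OF that])
  qed
  define g where "g z = (if z = z0 then f x0 else f (q (fst (fst z)) (snd z 0)))" for z :: "'b test_point"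
  have ge: "g (e s r) = f (q (fst (fst s)) r)" if "s \<in> S" for s r
    using q(2)[OF SN[OF that]] by (auto simp: g_def e_def z0_def fun_eq_iff)
  have g: "continuous_map Z Y g"
  proof (rule continuous_map_from_hedgehog[OF Z])
    fix s assume s: "s \<in> S"
    have "continuous_map unit_interval Y (f \<circ> q (fst (fst s)))"
      by (rule continuous_map_compose[OF q(1)[OF SN[OF s], unfolded pathin_def] f])
    moreover have "f \<circ> q (fst (fst s)) = g \<circ> e s"
      using ge[OF s] by (auto simp: fun_eq_iff)
    ultimately have "continuous_map unit_interval Y (g \<circ> e s)"
      by simp
    then show "continuous_map (Zs s) Y g"
      using continuous_compose_quotient_map[of unit_interval "Zs s" "e s" Y g] Zs[of s]
      by (simp add: homeomorphic_map_def)
  next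
    fix W assume W: "openin Y W" "g z0 \<in> W"
    then have "W \<in> \<N>"
      by (simp add: \<N>_def g_def)
    then have tS: "((W, 0), \<lambda>_. 0) \<in> S"
      by (auto simp: S_def)
    have "g \<in> topspace (Zs s) \<rightarrow> W" if s: "s \<in> S" "le ((W, 0), \<lambda>_. 0) s" for s
    proof -
      have "fst (fst s) \<subseteq> W"
        using s(2) by (simp add: le_def)
      then show ?thesis
        using q(4)[OF SN[OF s(1)]] unfolding topZs by (auto simp: ge[OF s(1)])
    qed
    with tS show "\<exists>t\<in>S. \<forall>s\<in>S. le t s \<and> \<not> le s t \<longrightarrow> g \<in> topspace (Zs s) \<rightarrow> W"
      by blast
  qed
  obtain h where h: "continuous_map Z X h" "h z0 = x0" "\<And>z. z \<in> topspace Z \<Longrightarrow> f (h z) = g z"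
    using lift[OF Z g x0] by (auto simp: g_def)
  have tip: "h (e s 1) \<notin> V" if s: "s \<in> S" for s
  proof -
    have "continuous_map unit_interval X (h \<circ> ((\<lambda>z. z) \<circ> e s))"
      by (intro continuous_map_compose[OF _ h(1)] continuous_map_compose[OF _ continuous_map_hedgehog_spine[OF Z s]]
          homeomorphic_imp_continuous_map[OF Zs])
    then have "pathin X (\<lambda>r. h (e s r))"
      by (simp add: pathin_def o_def)
    moreover have "f (h (e s r)) = f (q (fst (fst s)) r)" if "r \<in> {0..1}" for r
    proof -
      have "e s r \<in> topspace Z"
        unfolding topspace_hedgehog[OF Z] topZs using s that by blast
      then show ?thesis
        using h(3) ge[OF s] by simp
    qed
    moreover have "h (e s 0) = q (fst (fst s)) 0"
      using h(2) q(2)[OF SN[OF s]] by (simp add: e_def)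
    ultimately have "h (e s 1) = q (fst (fst s)) 1"
      using uniq[unfolded uniqueness_of_path_lifts_def, rule_format,
          of "\<lambda>r. h (e s r)" "q (fst (fst s))" 1] q(1)[OF SN[OF s]] by simp
    then show ?thesis
      using q(3)[OF SN[OF s]] by simp
  qed
  have "openin Z {z \<in> topspace Z. h z \<in> V}"
    by (rule openin_continuous_map_preimage[OF h(1) V(1)])
  then have "\<exists>t\<in>S. \<forall>s\<in>S. le t s \<and> \<not> le s t \<longrightarrow> topspace (Zs s) \<subseteq> {z \<in> topspace Z. h z \<in> V}"
    using h(2) V(2) hedgehog_base_in_topspace[OF Z] unfolding openin_hedgehog_iff[OF Z] by simp
  then obtain t where t: "t \<in> S"
    "\<And>s. s \<in> S \<Longrightarrow> le t s \<and> \<not> le s t \<Longrightarrow> topspace (Zs s) \<subseteq> {z \<in> topspace Z. h z \<in> V}"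
    by blast
  obtain U n where Un: "t = ((U, n), \<lambda>_. 0)" "U \<in> \<N>"
    using t(1) by (auto simp: S_def)
  define s :: "'b test_point" where "s = ((U, Suc n), \<lambda>_. 0)"
  have s: "s \<in> S" "le t s \<and> \<not> le s t"
    using Un by (auto simp: S_def s_def le_def)
  moreover have "e s 1 \<in> topspace (Zs s)"
    unfolding topZs by simp
  ultimately show False
    using t(2) tip by blast
qed

section \<open>Testing with contractible spaces\<close>

text \<open>The unique lifting condition speaks about spaces with points of one type only. A contractible space
  whose points inject into that type has a homeomorphic copy there, along which lifts are transported.\<close>

lemma lift_from_contractible_copy:
  fixes K :: "'c topology" and e :: "'c \<Rightarrow> 'k"
  assumes lifts: "unique_simply_connected_lifts TYPE('k) X Y f"
    and K: "locally_path_connected_space K" "contractible_space K" and e: "inj_on e (topspace K)"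
    and g: "continuous_map K Y g" and k0: "k0 \<in> topspace K" and x0: "x0 \<in> topspace X" "g k0 = f x0"
  shows "\<exists>h. (continuous_map K X h \<and> h k0 = x0 \<and> (\<forall>k\<in>topspace K. f (h k) = g k)) \<and>
    (\<forall>h'. continuous_map K X h' \<and> h' k0 = x0 \<and> (\<forall>k\<in>topspace K. f (h' k) = g k) \<longrightarrow>
      (\<forall>k\<in>topspace K. h' k = h k))"
proof -
  obtain Z where "homeomorphic_map K Z e"
    using homeomorphic_copy[OF e] .
  then obtain d where ed: "homeomorphic_maps K Z e d"
    unfolding homeomorphic_map_maps by blast
  then have ec: "continuous_map K Z e" and dc: "continuous_map Z K d"
    and de: "\<And>k. k \<in> topspace K \<Longrightarrow> d (e k) = k" and ed': "\<And>z. z \<in> topspace Z \<Longrightarrow> e (d z) = z"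
    by (auto simp: homeomorphic_maps_def)
  have eZ: "e k \<in> topspace Z" if "k \<in> topspace K" for k
    using ec that by (auto simp: continuous_map_def)
  have dK: "d z \<in> topspace K" if "z \<in> topspace Z" for z
    using dc that by (auto simp: continuous_map_def)
  have KZ: "K homeomorphic_space Z"
    using ed homeomorphic_space_def by blast
  have "contractible_space Z"
    using K(2) homeomorphic_space_contractibility[OF KZ] by simp
  moreover have "locally_path_connected_space Z"
    using K(1) homeomorphic_locally_path_connected_space[OF KZ] by simp
  ultimately have "peano_space Z \<and> simply_connected_space Z"
    by (simp add: peano_space_def contractible_imp_connected_space contractible_imp_simply_connected_space)
  moreover have "continuous_map Z Y (g \<circ> d)" "(g \<circ> d) (e k0) = f x0" "e k0 \<in> topspace Z"
    using continuous_map_compose[OF dc g] x0 k0 de eZ by auto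
  ultimately obtain h where h: "continuous_map Z X h" "h (e k0) = x0" "\<And>z. z \<in> topspace Z \<Longrightarrow> f (h z) = (g \<circ> d) z"
    and unique: "\<And>h' z. continuous_map Z X h' \<Longrightarrow> h' (e k0) = x0 \<Longrightarrow>
      (\<forall>z\<in>topspace Z. f (h' z) = (g \<circ> d) z) \<Longrightarrow> z \<in> topspace Z \<Longrightarrow> h' z = h z"
    using lifts[unfolded unique_simply_connected_lifts_def, rule_format, of x0 Z "e k0" "g \<circ> d"] x0
    by blast
  show ?thesis
  proof (intro exI[of _ "h \<circ> e"] conjI allI impI ballI)
    show "continuous_map K X (h \<circ> e)"
      by (rule continuous_map_compose[OF ec h(1)])
    show "(h \<circ> e) k0 = x0"
      using h(2) by simp
    show "f ((h \<circ> e) k) = g k" if "k \<in> topspace K" for k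
      using h(3)[OF eZ[OF that]] de[OF that] by simp
  next
    fix h' k
    assume h': "continuous_map K X h' \<and> h' k0 = x0 \<and> (\<forall>k\<in>topspace K. f (h' k) = g k)"
      and k: "k \<in> topspace K"
    then have h'd: "continuous_map Z X (h' \<circ> d)"
      using continuous_map_compose[OF dc] by blast
    have "(h' \<circ> d) (e k) = h (e k)"
      by (rule unique[OF h'd]) (use h' k k0 de dK eZ in auto)
    then show "h' k = (h \<circ> e) k"
      using de[OF k] by simp
  qed
qed

lemma uniqueness_of_path_lifts_if_unique_simply_connected_lifts:
  fixes e :: "real \<Rightarrow> 'k"
  assumes lifts: "unique_simply_connected_lifts TYPE('k) X Y f" and f: "continuous_map X Y f"
    and e: "inj_on e {0..1}"
  shows "uniqueness_of_path_lifts X f"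
  unfolding uniqueness_of_path_lifts_def
proof (intro allI impI ballI, elim conjE)
  fix \<alpha> \<beta> and t :: real
  assume ab: "pathin X \<alpha>" "pathin X \<beta>" "\<forall>t\<in>{0..1}. f (\<alpha> t) = f (\<beta> t)" "\<alpha> 0 = \<beta> 0" and t: "t \<in> {0..1}"
  have g: "continuous_map unit_interval Y (f \<circ> \<alpha>)"
    using pathin_compose[OF ab(1) f] by (simp add: pathin_def)
  have contractible: "contractible_space unit_interval"
    by (simp only: contractible_space_subtopology_euclideanreal is_interval_cc)
  have "\<exists>h. \<forall>h'. continuous_map unit_interval X h' \<and> h' 0 = \<alpha> 0 \<and> (\<forall>k\<in>topspace unit_interval. f (h' k) = (f \<circ> \<alpha>) k) \<longrightarrow>
      (\<forall>k\<in>topspace unit_interval. h' k = h k)"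
    using lift_from_contractible_copy[OF lifts locally_path_connected_real_interval(1) contractible _ g, of e 0 "\<alpha> 0"]
      e path_start_in_topspace[OF ab(1)] by auto
  then obtain h where h: "\<And>h'. continuous_map unit_interval X h' \<Longrightarrow> h' 0 = \<alpha> 0 \<Longrightarrow>
      (\<forall>k\<in>topspace unit_interval. f (h' k) = (f \<circ> \<alpha>) k) \<Longrightarrow> (\<forall>k\<in>topspace unit_interval. h' k = h k)"
    by blast
  have "\<alpha> t = h t"
    using h[of \<alpha>] ab t by (simp add: pathin_def)
  moreover have "\<beta> t = h t"
    using h[of \<beta>] ab t by (simp add: pathin_def)
  ultimately show "\<alpha> t = \<beta> t"
    by simp
qed

text \<open>Lift the homotopy from the corner of the contractible square; uniqueness of path lifts makes the lift agree with
  the given one on the bottom edge.\<close>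

lemma homotopy_lifting_property_interval_if_unique_simply_connected_lifts:
  fixes e :: "real \<times> real \<Rightarrow> 'k"
  assumes lifts: "unique_simply_connected_lifts TYPE('k) X Y f" and f: "continuous_map X Y f"
    and e: "inj_on e ({0..1} \<times> {0..1})"
  shows "homotopy_lifting_property X Y f unit_interval"
  unfolding homotopy_lifting_property_iff
proof (intro allI impI, elim conjE)
  fix a H
  assume a: "continuous_map unit_interval X a"
    and H: "continuous_map (prod_topology unit_interval unit_interval) Y H"
    and eq: "\<forall>k\<in>topspace unit_interval. f (a k) = H (k, 0)"
  have uniq: "uniqueness_of_path_lifts X f"
  proof (rule uniqueness_of_path_lifts_if_unique_simply_connected_lifts[OF lifts f])
    show "inj_on (\<lambda>t. e (t, 0)) {0..1}"
      by (rule inj_onI) (drule inj_onD[OF e]; simp)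
  qed
  have "locally_path_connected_space (prod_topology unit_interval unit_interval)"
    using locally_path_connected_real_interval(1)[of 0 1]
    by (simp add: locally_path_connected_space_prod_topology del: prod_topology_subtopology_eu)
  moreover have "contractible_space (prod_topology unit_interval unit_interval)"
    by (simp add: contractible_space_prod_topology is_interval_cc del: prod_topology_subtopology_eu contractible_space_top_of_set)
  moreover have "a 0 \<in> topspace X" "H (0, 0) = f (a 0)"
    using a eq by (auto simp: continuous_map_def)
  ultimately obtain G where G: "continuous_map (prod_topology unit_interval unit_interval) X G"
    "G (0, 0) = a 0" "\<And>w. w \<in> {0..1} \<times> {0..1} \<Longrightarrow> f (G w) = H w"
    using lift_from_contractible_copy[OF lifts _ _ _ H, of e "(0, 0)" "a 0"] e by auto
  have "continuous_map unit_interval (prod_topology unit_interval unit_interval) (\<lambda>s. (s, 0))"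
    by (auto intro!: continuous_intros)
  from continuous_map_compose[OF this G(1)] have "pathin X (\<lambda>s. G (s, 0))"
    by (simp add: pathin_def o_def)
  then have "G (s, 0) = a s" if "s \<in> {0..1}" for s
    using uniq[unfolded uniqueness_of_path_lifts_def, rule_format, of "\<lambda>s. G (s, 0)" a s] a G eq that
    by (simp add: pathin_def)
  then show "\<exists>G. continuous_map (prod_topology unit_interval unit_interval) X G \<and>
           (\<forall>k\<in>topspace unit_interval. G (k, 0) = a k) \<and>
           (\<forall>k\<in>topspace unit_interval. \<forall>t\<in>{0..1}. f (G (k, t)) = H (k, t))"
    using G by (intro exI[of _ G]) simp
qed

section \<open>Equivalence of the lifting conditions\<close>

lemma locally_path_connected_space_cube: "locally_path_connected_space (cube n)"
  unfolding cube_def locally_path_connected_space_product_topology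
  using locally_path_connected_real_interval(1)[of 0 1] by (auto simp: is_interval_path_connected is_interval_cc)

lemma interval_retract_of_cube:
  "retraction_maps (cube 1) unit_interval (\<lambda>v. v 0) (\<lambda>t. \<lambda>i\<in>{..<1}. t)"
proof -
  have "continuous_map (cube 1) unit_interval (\<lambda>v. v 0)"
    unfolding cube_def by (rule continuous_map_product_projection) simp
  moreover have "continuous_map unit_interval (cube 1) (\<lambda>t. \<lambda>i\<in>{..<1}. t)"
    unfolding cube_def continuous_map_componentwise by auto
  ultimately show ?thesis
    by (simp add: retraction_maps_def)
qed

lemma serre_fibration_homotopy_lifting_interval:
  "serre_fibration X Y f \<Longrightarrow> homotopy_lifting_property X Y f unit_interval"
  using homotopy_lifting_property_retract[OF interval_retract_of_cube] by (auto simp: serre_fibration_def)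

text \<open>For Peano maps with unique path lifting, lifting homotopies over the interval already implies lifting
  them over cubes, and the
  condition on fibres is another form of unique path lifting. The three lifting conditions are each
  compared with this characterization.\<close>

lemma peano_covering_map_iff:
  assumes f: "continuous_map X Y f" and lpcX: "locally_path_connected_space X"
  shows "peano_covering_map X Y f \<longleftrightarrow> peano_map X Y f \<and>
    homotopy_lifting_property X Y f unit_interval \<and> uniqueness_of_path_lifts X f"
proof
  assume "peano_covering_map X Y f"
  then have "peano_map X Y f" and "serre_fibration X Y f"
    and triv: "\<forall>y\<in>topspace Y. \<forall>C\<in>path_components_of (subtopology X {x \<in> topspace X. f x = y}). \<exists>x. C = {x}"
    by (simp_all add: peano_covering_map_def)
  moreover from this have hlp: "homotopy_lifting_property X Y f unit_interval"
    by (intro serre_fibration_homotopy_lifting_interval)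
  ultimately show "peano_map X Y f \<and> homotopy_lifting_property X Y f unit_interval \<and> uniqueness_of_path_lifts X f"
    using uniqueness_of_path_lifts_if_fibres_trivial[OF hlp f triv] by simp
next
  assume *: "peano_map X Y f \<and> homotopy_lifting_property X Y f unit_interval \<and> uniqueness_of_path_lifts X f"
  then have "homotopy_lifting_property X Y f (cube n)" for n
    by (intro homotopy_lifting_property_locally_path_connected[OF lpcX f _ _ _ locally_path_connected_space_cube]) simp_all
  then have "serre_fibration X Y f"
    using f by (simp add: serre_fibration_def)
  with * show "peano_covering_map X Y f"
    unfolding peano_covering_map_def using path_components_of_fibre_trivial[of X f] by simp
qed

lemma peano_fibration_imp_hedgehog_fibration:
  fixes X :: "'a topology" and Y :: "'b topology"
  assumes "peano_fibration TYPE('k) X Y f"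
  shows "hedgehog_fibration TYPE('s) TYPE('k) X Y f"
  unfolding hedgehog_fibration_def
proof (intro conjI allI impI)
  show "continuous_map X Y f"
    using assms by (simp add: peano_fibration_def)
  show "homotopy_lifting_property X Y f Z" if "hedgehog S le Zs z0 Z"
    for S :: "'s set" and le z0 Zs and Z :: "'k topology"
    using assms hedgehog_imp_peano_space[OF that] by (simp add: peano_fibration_def)
qed

lemma peano_covering_map_imp_peano_fibration:
  assumes f: "continuous_map X Y f" and lpcX: "locally_path_connected_space X"
    and "peano_covering_map X Y f"
  shows "peano_fibration TYPE('k) X Y f"
proof -
  have "homotopy_lifting_property X Y f K" if "peano_space K" for K :: "'k topology"
    by (rule homotopy_lifting_property_locally_path_connected[OF lpcX f])
      (use assms(3) that in \<open>simp_all add: peano_covering_map_iff[OF f lpcX] peano_space_def\<close>)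
  then show ?thesis
    using f by (simp add: peano_fibration_def)
qed

lemma peano_covering_map_imp_unique_simply_connected_lifts:
  assumes f: "continuous_map X Y f" and lpcX: "locally_path_connected_space X"
    and cov: "peano_covering_map X Y f"
  shows "unique_simply_connected_lifts TYPE('k) X Y f"
  unfolding unique_simply_connected_lifts_def
proof (intro ballI allI impI, elim conjE)
  fix x0 and Z :: "'k topology" and z0 g
  assume x0: "x0 \<in> topspace X" and Z: "peano_space Z" "simply_connected_space Z" and z0: "z0 \<in> topspace Z"
    and g: "continuous_map Z Y g" "g z0 = f x0"
  have pm: "peano_map X Y f" and hlp: "homotopy_lifting_property X Y f unit_interval"
    and uniq: "uniqueness_of_path_lifts X f"
    using cov unfolding peano_covering_map_iff[OF f lpcX] by simp_all
  have lpcZ: "locally_path_connected_space Z" and pcZ: "path_connected_space Z"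
    using Z by (simp_all add: peano_space_def simply_connected_space_def)
  obtain h where h: "continuous_map Z X h" "h z0 = x0" "\<And>z. z \<in> topspace Z \<Longrightarrow> f (h z) = g z"
    by (rule lift_from_simply_connected[OF lpcX f pm hlp uniq lpcZ Z(2) g(1) z0 x0 g(2)]) blast
  show "\<exists>h. (continuous_map Z X h \<and> h z0 = x0 \<and> (\<forall>z\<in>topspace Z. f (h z) = g z)) \<and>
      (\<forall>h'. continuous_map Z X h' \<and> h' z0 = x0 \<and> (\<forall>z\<in>topspace Z. f (h' z) = g z) \<longrightarrow>
         (\<forall>z\<in>topspace Z. h' z = h z))"
  proof (intro exI[of _ h] conjI allI impI ballI)
    fix h' z
    assume "continuous_map Z X h' \<and> h' z0 = x0 \<and> (\<forall>z\<in>topspace Z. f (h' z) = g z)" "z \<in> topspace Z"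
    then show "h' z = h z"
      using lift_from_path_connected_unique[OF uniq pcZ z0, of h' h z] h by simp
  qed (use h in auto)
qed

text \<open>A copy of the interval is a hedgehog, so homotopies over the interval can be lifted.\<close>

lemma hedgehog_fibration_imp_peano_covering_map:
  fixes X :: "'a topology" and Y :: "'b topology"
  assumes f: "continuous_map X Y f" and lpcX: "locally_path_connected_space X"
    and hf: "hedgehog_fibration TYPE('b test_point) TYPE('b test_point) X Y f"
    and uniq: "uniqueness_of_path_lifts X f"
  shows "peano_covering_map X Y f"
proof -
  have hlp: "homotopy_lifting_property X Y f Z"
    if "hedgehog S le Zs z0 Z" for S :: "'b test_point set" and le z0 Z and Zs :: "_ \<Rightarrow> 'b test_point topology"
    using hf[unfolded hedgehog_fibration_def, THEN conjunct2, rule_format, OF that] .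
  define e :: "real \<Rightarrow> 'b test_point" where "e r = (({}, 0), \<lambda>_. r)" for r
  have "inj_on e (topspace unit_interval)"
    by (auto simp: inj_on_def e_def fun_eq_iff)
  then obtain Z where Z: "homeomorphic_map unit_interval Z e"
    by (rule homeomorphic_copy)
  then obtain d where "homeomorphic_maps unit_interval Z e d"
    unfolding homeomorphic_map_maps by blast
  then have "retraction_maps Z unit_interval d e"
    by (auto simp: homeomorphic_maps_def retraction_maps_def)
  then have "homotopy_lifting_property X Y f unit_interval"
    by (rule homotopy_lifting_property_retract) (rule hlp[OF unit_interval_copy_hedgehog[OF Z]])
  moreover have "peano_map X Y f"
    by (rule peano_map_if_lifts_from_hedgehogs[OF lpcX f uniq]) (rule lift_from_hedgehog[OF _ hlp uniq])
  ultimately show ?thesis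
    using uniq peano_covering_map_iff[OF f lpcX] by simp
qed

text \<open>The interval and the square have copies among the test spaces, and hedgehogs are contractible Peano
  spaces.\<close>

lemma unique_simply_connected_lifts_imp_peano_covering_map:
  fixes X :: "'a topology" and Y :: "'b topology"
  assumes f: "continuous_map X Y f" and lpcX: "locally_path_connected_space X"
    and lifts: "unique_simply_connected_lifts TYPE('b test_point) X Y f"
  shows "peano_covering_map X Y f"
proof -
  define e :: "real \<times> real \<Rightarrow> 'b test_point" where "e w = (({}, 0), \<lambda>i. if i = 0 then fst w else snd w)" for w
  have e: "inj_on e ({0..1} \<times> {0..1})"
    by (auto simp: inj_on_def e_def fun_eq_iff split: if_splits)
  have uniq: "uniqueness_of_path_lifts X f"
  proof (rule uniqueness_of_path_lifts_if_unique_simply_connected_lifts[OF lifts f])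
    show "inj_on (\<lambda>t. e (t, 0)) {0..1}"
      by (rule inj_onI) (drule inj_onD[OF e]; simp)
  qed
  have "peano_map X Y f"
  proof (rule peano_map_if_lifts_from_hedgehogs[OF lpcX f uniq])
    fix S :: "'b test_point set" and le z0 and Z :: "'b test_point topology" and Zs g x0
    assume Z: "hedgehog S le Zs z0 Z" and "continuous_map Z Y g" "x0 \<in> topspace X" "g z0 = f x0"
    moreover have "peano_space Z" "simply_connected_space Z" "z0 \<in> topspace Z"
      using hedgehog_imp_peano_space[OF Z] hedgehog_base_in_topspace[OF Z]
        contractible_imp_simply_connected_space[OF hedgehog_imp_contractible_space[OF Z]] by auto
    ultimately show "\<exists>h. continuous_map Z X h \<and> h z0 = x0 \<and> (\<forall>z\<in>topspace Z. f (h z) = g z)"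
      using lifts[unfolded unique_simply_connected_lifts_def, rule_format, of x0 Z z0 g] by blast
  qed
  then show ?thesis
    using uniq homotopy_lifting_property_interval_if_unique_simply_connected_lifts[OF lifts f e]
      peano_covering_map_iff[OF f lpcX] by simp
qed

theorem theorem6p5:
  fixes X :: "'a topology" and Y :: "'b topology" and f :: "'a \<Rightarrow> 'b"
  assumes "continuous_map X Y f" and "locally_path_connected_space X"
  shows "(peano_covering_map X Y f \<longleftrightarrow>
            peano_fibration TYPE('b test_point) X Y f \<and> uniqueness_of_path_lifts X f)
       \<and> (peano_covering_map X Y f \<longleftrightarrow>
            hedgehog_fibration TYPE('b test_point) TYPE('b test_point) X Y f
              \<and> uniqueness_of_path_lifts X f)
       \<and> (peano_covering_map X Y f \<longleftrightarrow>
            unique_simply_connected_lifts TYPE('b test_point) X Y f)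
       \<and> (peano_covering_map X Y f \<longrightarrow>
            peano_fibration TYPE('k) X Y f \<and>
            hedgehog_fibration TYPE('s) TYPE('k) X Y f \<and>
            unique_simply_connected_lifts TYPE('k) X Y f)"
proof -
  have uniq: "uniqueness_of_path_lifts X f" if "peano_covering_map X Y f"
    using that peano_covering_map_iff[OF assms] by simp
  have peano: "peano_fibration TYPE('b test_point) X Y f" "peano_fibration TYPE('k) X Y f"
    if "peano_covering_map X Y f"
    by (rule peano_covering_map_imp_peano_fibration[OF assms that])+
  have hedgehog: "hedgehog_fibration TYPE('b test_point) TYPE('b test_point) X Y f"
    if "peano_fibration TYPE('b test_point) X Y f"
    by (rule peano_fibration_imp_hedgehog_fibration[OF that])
  have hedgehog': "hedgehog_fibration TYPE('s) TYPE('k) X Y f" if "peano_fibration TYPE('k) X Y f"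
    by (rule peano_fibration_imp_hedgehog_fibration[OF that])
  have lifts: "unique_simply_connected_lifts TYPE('b test_point) X Y f"
    "unique_simply_connected_lifts TYPE('k) X Y f" if "peano_covering_map X Y f"
    by (rule peano_covering_map_imp_unique_simply_connected_lifts[OF assms that])+
  show ?thesis
    using uniq peano hedgehog hedgehog' lifts hedgehog_fibration_imp_peano_covering_map[OF assms]
      unique_simply_connected_lifts_imp_peano_covering_map[OF assms]
    by blast
qed

end
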